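(* Let $G$ be a strongly connected bridgeless mixed multigraph of radius $r \geq 1$ and let $\eta(G)=\eta$ denote the smallest integer $k$ such that every edge of $G$ belongs to a cycle of length at most $k$. Then the oriented radius of $G$ is at most $$1.5\, r \eta - 0.375(\eta-1)(\eta-3) - 2r + 1 \ \leq\ 1.5\, r \eta .$$
   Context: A mixed multigraph is a finite multigraph in which each edge may be either directed or undirected. A walk from $v_1$ to $v_k$ is a sequence of vertices $v_1,\dots,v_k$ such that for each $i \in \{1,\dots,k-1\}$ there is either an undirected edge $\{v_i,v_{i+1}\}$ or an edge directed from $v_i$ to $v_{i+1}$. A trail is a walk without repeated edges; a path is a trail without repeated vertices, except possibly $v_1=v_k$. A cycle is a closed path ($v_1=v_k$, with at least one edge), so directed edges are traversed along their direction and no edge is used twice; parallel edges may form a cycle of length 2. The length of a path or cycle is its number of edges. A mixed multigraph is strongly connected if there is a path from each vertex to every other vertex. A bridge in a strongly connected mixed multigraph is an undirected edge whose removal makes the graph no longer strongly connected; the graph is bridgeless if it has no bridge. An orientation of a mixed multigraph $G$ is an assignment of exactly one direction to each undirected edge of $G$ (directed edges keep their direction); the result is a directed multigraph. The distance $d_G(u,v)$ is the length of a shortest path from $u$ to $v$. The eccentricity of a vertex $u$ is $e(u)=\max\{\max_{v} d_G(u,v),\ \max_{v} d_G(v,u)\}$, and the radius of $G$ is $\min_{u\in V(G)} e(u)$ (infinite if $G$ is not strongly connected). The oriented radius of $G$ is the minimum radius of an orientation of $G$. *)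

theory Defs
  imports "HOL-Library.Extended_Real" "HOL-Library.Uprod"
begin

text \<open>Edges carry identities of type \<open>'e\<close>, so parallel edges are allowed. \<open>Upair v v\<close> is an
  unordered pair, so undirected and directed loops are allowed as well.\<close>

datatype 'v ends = Undirected "'v uprod" | Directed 'v 'v

record ('v, 'e) mixed_multigraph =
  verts :: "'v set"
  edges :: "'e set"
  ends :: "'e \<Rightarrow> 'v ends"

fun ends_set :: "'v ends \<Rightarrow> 'v set" where
  "ends_set (Undirected p) = set_uprod p"
| "ends_set (Directed u v) = {u, v}"

definition finite_mixed_multigraph :: "('v, 'e) mixed_multigraph \<Rightarrow> bool" where
  "finite_mixed_multigraph G \<longleftrightarrow>
     finite (verts G) \<and> finite (edges G) \<and> (\<forall>e\<in>edges G. ends_set (ends G e) \<subseteq> verts G)"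

definition traversable :: "('v, 'e) mixed_multigraph \<Rightarrow> 'v \<Rightarrow> 'e \<Rightarrow> 'v \<Rightarrow> bool" where
  "traversable G u e v \<longleftrightarrow>
     e \<in> edges G \<and> (ends G e = Undirected (Upair u v) \<or> ends G e = Directed u v)"

text \<open>A walk records, besides its vertex sequence \<open>vs\<close>, the edges \<open>es\<close> it uses; in a multigraph
  this is needed to say that no edge is repeated.\<close>

definition is_walk :: "('v, 'e) mixed_multigraph \<Rightarrow> 'v list \<Rightarrow> 'e list \<Rightarrow> bool" where
  "is_walk G vs es \<longleftrightarrow>
     length vs = Suc (length es) \<and> set vs \<subseteq> verts G \<and>
     (\<forall>i<length es. traversable G (vs ! i) (es ! i) (vs ! Suc i))"

definition is_trail :: "('v, 'e) mixed_multigraph \<Rightarrow> 'v list \<Rightarrow> 'e list \<Rightarrow> bool" where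
  "is_trail G vs es \<longleftrightarrow> is_walk G vs es \<and> distinct es"

text \<open>The only coincidence of vertices permitted on a path is that of the first and the last one.\<close>

definition is_path :: "('v, 'e) mixed_multigraph \<Rightarrow> 'v list \<Rightarrow> 'e list \<Rightarrow> bool" where
  "is_path G vs es \<longleftrightarrow>
     is_trail G vs es \<and>
     (\<forall>i j. i < j \<and> j < length vs \<and> vs ! i = vs ! j \<longrightarrow> i = 0 \<and> Suc j = length vs)"

definition is_path_from_to ::
    "('v, 'e) mixed_multigraph \<Rightarrow> 'v \<Rightarrow> 'v list \<Rightarrow> 'e list \<Rightarrow> 'v \<Rightarrow> bool" where
  "is_path_from_to G u vs es v \<longleftrightarrow> is_path G vs es \<and> hd vs = u \<and> last vs = v"

definition is_cycle :: "('v, 'e) mixed_multigraph \<Rightarrow> 'v list \<Rightarrow> 'e list \<Rightarrow> bool" where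
  "is_cycle G vs es \<longleftrightarrow> is_path G vs es \<and> hd vs = last vs \<and> es \<noteq> []"

definition strongly_connected :: "('v, 'e) mixed_multigraph \<Rightarrow> bool" where
  "strongly_connected G \<longleftrightarrow>
     (\<forall>u\<in>verts G. \<forall>v\<in>verts G. u \<noteq> v \<longrightarrow> (\<exists>vs es. is_path_from_to G u vs es v))"

definition remove_edge :: "('v, 'e) mixed_multigraph \<Rightarrow> 'e \<Rightarrow> ('v, 'e) mixed_multigraph" where
  "remove_edge G e = G\<lparr>edges := edges G - {e}\<rparr>"

definition is_bridge :: "('v, 'e) mixed_multigraph \<Rightarrow> 'e \<Rightarrow> bool" where
  "is_bridge G e \<longleftrightarrow>
     e \<in> edges G \<and> (\<exists>p. ends G e = Undirected p) \<and> \<not> strongly_connected (remove_edge G e)"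

definition bridgeless :: "('v, 'e) mixed_multigraph \<Rightarrow> bool" where
  "bridgeless G \<longleftrightarrow> (\<nexists>e. is_bridge G e)"

text \<open>In \<open>enat\<close> the infimum of the empty set is \<open>\<infinity>\<close>, so the distance is \<open>\<infinity>\<close> if there is no path.\<close>

definition distance :: "('v, 'e) mixed_multigraph \<Rightarrow> 'v \<Rightarrow> 'v \<Rightarrow> enat" where
  "distance G u v = Inf {enat (length es) | vs es. is_path_from_to G u vs es v}"

definition eccentricity :: "('v, 'e) mixed_multigraph \<Rightarrow> 'v \<Rightarrow> enat" where
  "eccentricity G u = max (SUP v\<in>verts G. distance G u v) (SUP v\<in>verts G. distance G v u)"

definition radius :: "('v, 'e) mixed_multigraph \<Rightarrow> enat" where
  "radius G = (INF u\<in>verts G. eccentricity G u)"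

text \<open>An orientation is a directed multigraph, viewed as a mixed multigraph all of whose edges are
  directed.\<close>

definition is_orientation ::
    "('v, 'e) mixed_multigraph \<Rightarrow> ('v, 'e) mixed_multigraph \<Rightarrow> bool" where
  "is_orientation G D \<longleftrightarrow>
     verts D = verts G \<and> edges D = edges G \<and>
     (\<forall>e\<in>edges G. \<exists>u v. ends D e = Directed u v \<and>
        (ends G e = Directed u v \<or> ends G e = Undirected (Upair u v)))"

definition oriented_radius :: "('v, 'e) mixed_multigraph \<Rightarrow> enat" where
  "oriented_radius G = Inf {radius D | D. is_orientation G D}"

text \<open>In a strongly connected bridgeless graph every edge lies on a cycle, so that the minimum
  exists.\<close>

definition eta :: "('v, 'e) mixed_multigraph \<Rightarrow> nat" where
  "eta G = (LEAST k. \<forall>e\<in>edges G. \<exists>vs es. is_cycle G vs es \<and> e \<in> set es \<and> length es \<le> k)"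

end

theory Submission
  imports Defs
begin

text \<open>Fix a centre \<open>c\<close> and grow an oriented core \<open>X\<close> around it, treating \<open>X\<close> as one contracted
  vertex. When all vertices have distance at most \<open>i\<close> to and from \<open>X\<close>, every edge leaving \<open>X\<close>
  lies on an ear of length at most \<open>L = min \<eta> (2 i + 1)\<close>. All neighbours of \<open>X\<close> can then be
  absorbed at a cost of \<open>2 L - 3\<close> in the distances from \<open>c\<close> and \<open>L - 1\<close> in the distances to \<open>c\<close>,
  or, reversing all edges, with the two costs exchanged. Choosing the direction so that the two
  distances stay balanced, the \<open>r\<close> steps cost \<open>3 L / 2 - 2\<close> each on average, and the sum of
  these numbers plus 1 is at most the claimed bound.\<close>

section \<open>Walks along darts\<close>

text \<open>An undirected crossing edge may close an ear in one direction only, and two ears may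
  want the same edge in opposite directions, so ears cannot be added independently. The asymmetric
  cost is the price of avoiding such conflicts: vertices on ways back to \<open>X\<close> cost at
  most \<open>L - 1\<close> in both directions, but the remaining inward edges are served from those
  vertices instead of from \<open>X\<close>, by at most \<open>L - 2\<close> further steps, and (L -
  1) + (L - 2) = 2 L - 3. The two costs add up to 3 L - 4, hence 3 L / 2 - 2 per step after
  balancing. The bound 2 i + 1 counts i steps from \<open>X\<close> to the edge, the edge itself,
  and i steps back; absence of bridges is what guarantees that some ear is this short. Each
  expansion lowers the distance to the core by one, so i runs from r down to 1. Balancing may leave
  a final imbalance of 2, and half of it is the summand 1.\<close>

text \<open>A dart is an edge together with a direction in which it can be traversed, so an undirected edge
  \<open>e\<close> gives two darts \<open>(a, e, b)\<close> and \<open>(b, e, a)\<close>.\<close>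

definition darts :: "('v, 'e) mixed_multigraph \<Rightarrow> ('v \<times> 'e \<times> 'v) set" where
  "darts G = {(a, e, b). traversable G a e b}"

definition arcs :: "('v \<times> 'e \<times> 'v) set \<Rightarrow> ('v \<times> 'v) set" where
  "arcs D = {(a, b). \<exists>e. (a, e, b) \<in> D}"

definition reverse :: "('v \<times> 'e \<times> 'v) set \<Rightarrow> ('v \<times> 'e \<times> 'v) set" where
  "reverse D = {(a, e, b). (b, e, a) \<in> D}"

definition delete :: "('v \<times> 'e \<times> 'v) set \<Rightarrow> 'e \<Rightarrow> ('v \<times> 'e \<times> 'v) set" where
  "delete D e = {(a, f, b). (a, f, b) \<in> D \<and> f \<noteq> e}"

definition outside :: "('v \<times> 'e \<times> 'v) set \<Rightarrow> 'v set \<Rightarrow> ('v \<times> 'e \<times> 'v) set" where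
  "outside D X = {(a, e, b). (a, e, b) \<in> D \<and> a \<notin> X \<and> b \<notin> X}"

text \<open>Walks may repeat vertices and edges, so they concatenate freely;
  \<open>path_of_reaches\<close> recovers a path of no greater length.\<close>

definition reaches :: "('v \<times> 'e \<times> 'v) set \<Rightarrow> nat \<Rightarrow> 'v \<Rightarrow> 'v \<Rightarrow> bool" where
  "reaches D n a b \<longleftrightarrow> (\<exists>k\<le>n. (a, b) \<in> arcs D ^^ k)"

text \<open>This is what arguments about bare dart sets retain of the function \<open>ends\<close>;
  it passes to subsets and to the reversal.\<close>

definition edge_ends_unique :: "('v \<times> 'e \<times> 'v) set \<Rightarrow> bool" where
  "edge_ends_unique D \<longleftrightarrow> (\<forall>a e b a' b'. (a, e, b) \<in> D \<longrightarrow> (a', e, b') \<in> D \<longrightarrow>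
     a' = a \<and> b' = b \<or> a' = b \<and> b' = a)"

definition oriented :: "('v \<times> 'e \<times> 'v) set \<Rightarrow> bool" where
  "oriented D \<longleftrightarrow> (\<forall>a e b a' b'. (a, e, b) \<in> D \<longrightarrow> (a', e, b') \<in> D \<longrightarrow> a' = a \<and> b' = b)"

lemma in_reverse [simp]: "(a, e, b) \<in> reverse D \<longleftrightarrow> (b, e, a) \<in> D"
  by (simp add: reverse_def)

lemma in_delete [simp]: "(a, f, b) \<in> delete D e \<longleftrightarrow> (a, f, b) \<in> D \<and> f \<noteq> e"
  by (simp add: delete_def)

lemma in_outside [simp]: "(a, e, b) \<in> outside D X \<longleftrightarrow> (a, e, b) \<in> D \<and> a \<notin> X \<and> b \<notin> X"
  by (simp add: outside_def)

lemma in_arcs: "(a, b) \<in> arcs D \<longleftrightarrow> (\<exists>e. (a, e, b) \<in> D)"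
  by (simp add: arcs_def)

lemma reverse_reverse [simp]: "reverse (reverse D) = D"
  by (auto simp: reverse_def)

lemma reverse_delete: "reverse (delete D e) = delete (reverse D) e"
  by (auto simp: reverse_def delete_def)

lemma reverse_outside: "reverse (outside D X) = outside (reverse D) X"
  by (auto simp: reverse_def outside_def)

lemma reverse_mono: "D \<subseteq> D' \<Longrightarrow> reverse D \<subseteq> reverse D'"
  by (auto simp: reverse_def)

lemma edge_ends_unique_reverse: "edge_ends_unique D \<Longrightarrow> edge_ends_unique (reverse D)"
  unfolding edge_ends_unique_def by (metis in_reverse)

lemma edge_ends_unique_subset: "edge_ends_unique D \<Longrightarrow> D' \<subseteq> D \<Longrightarrow> edge_ends_unique D'"
  unfolding edge_ends_unique_def by blast

lemma edge_ends_uniqueD: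
  "edge_ends_unique D \<Longrightarrow> (a, e, b) \<in> D \<Longrightarrow> (a', e, b') \<in> D \<Longrightarrow>
     a' = a \<and> b' = b \<or> a' = b \<and> b' = a"
  unfolding edge_ends_unique_def by blast

lemma oriented_reverse: "oriented D \<Longrightarrow> oriented (reverse D)"
  unfolding oriented_def by (metis in_reverse)

lemma orientedI:
  assumes "edge_ends_unique D"
    and "\<And>a e b. (a, e, b) \<in> D \<Longrightarrow> (b, e, a) \<in> D \<Longrightarrow> a = b"
  shows "oriented D"
  using assms unfolding oriented_def edge_ends_unique_def by metis

lemma arcs_reverse: "arcs (reverse D) = (arcs D)\<inverse>"
  by (auto simp: arcs_def)

lemma relpow_converse_iff:
  fixes R :: "('a \<times> 'a) set"
  shows "(a, b) \<in> (R\<inverse>) ^^ k \<longleftrightarrow> (b, a) \<in> R ^^ k"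
proof (induction k arbitrary: a b)
  case (Suc k)
  have "(a, b) \<in> (R\<inverse>) ^^ Suc k \<longleftrightarrow> (\<exists>y. (a, y) \<in> (R\<inverse>) ^^ k \<and> (b, y) \<in> R)"
    by auto
  also have "\<dots> \<longleftrightarrow> (\<exists>y. (b, y) \<in> R \<and> (y, a) \<in> R ^^ k)"
    using Suc.IH by blast
  also have "\<dots> \<longleftrightarrow> (b, a) \<in> R ^^ Suc k"
    by (metis relpow_Suc_D2 relpow_Suc_I2)
  finally show ?case .
qed auto

lemma reaches_reverse [simp]: "reaches (reverse D) n a b \<longleftrightarrow> reaches D n b a"
  by (simp add: reaches_def arcs_reverse relpow_converse_iff)

lemma reaches_refl [simp]: "reaches D n a a"
  unfolding reaches_def by (rule exI[of _ 0]) simp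

lemma relpow_mono_rel:
  fixes R :: "('a \<times> 'a) set"
  assumes "R \<subseteq> S"
  shows "R ^^ k \<subseteq> S ^^ k"
  using assms by (induction k) auto

lemma arcs_mono: "D \<subseteq> D' \<Longrightarrow> arcs D \<subseteq> arcs D'"
  by (auto simp: arcs_def)

lemma reaches_mono: "reaches D n a b \<Longrightarrow> D \<subseteq> D' \<Longrightarrow> n \<le> n' \<Longrightarrow> reaches D' n' a b"
  unfolding reaches_def
  by (meson arcs_mono order_trans relpow_mono_rel subsetD)

lemma reaches_trans: "reaches D m a b \<Longrightarrow> reaches D n b c \<Longrightarrow> reaches D (m + n) a c"
  unfolding reaches_def by (metis add_mono relpow_trans)

lemma reaches_dart: "(a, e, b) \<in> D \<Longrightarrow> reaches D 1 a b"
  unfolding reaches_def by (rule exI[of _ 1]) (auto simp: in_arcs)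

lemma reaches_snoc: "reaches D n a b \<Longrightarrow> (b, e, c) \<in> D \<Longrightarrow> reaches D (Suc n) a c"
  using reaches_trans[of D n a b 1 c] reaches_dart[of b e c D] by simp

lemma reaches_cons: "(a, e, b) \<in> D \<Longrightarrow> reaches D n b c \<Longrightarrow> reaches D (Suc n) a c"
  using reaches_trans[of D 1 a b n c] reaches_dart[of a e b D] by simp

lemma reaches_snoc_le:
  "reaches D m a b \<Longrightarrow> (b, e, c) \<in> D \<Longrightarrow> Suc m \<le> n \<Longrightarrow> reaches D n a c"
  by (blast intro: reaches_mono reaches_snoc)

lemma reaches_cons_le:
  "(a, e, b) \<in> D \<Longrightarrow> reaches D m b c \<Longrightarrow> Suc m \<le> n \<Longrightarrow> reaches D n a c"
  by (blast intro: reaches_mono reaches_cons)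

lemma reaches_0: "reaches D 0 a b \<longleftrightarrow> a = b"
  by (auto simp: reaches_def)

lemma reaches_Suc_snoc:
  "reaches D (Suc n) a b \<longleftrightarrow> a = b \<or> (\<exists>c e. reaches D n a c \<and> (c, e, b) \<in> D)"
proof
  assume "reaches D (Suc n) a b"
  then obtain k where k: "k \<le> Suc n" "(a, b) \<in> arcs D ^^ k"
    by (auto simp: reaches_def)
  show "a = b \<or> (\<exists>c e. reaches D n a c \<and> (c, e, b) \<in> D)"
  proof (cases k)
    case (Suc j)
    then show ?thesis using k by (auto simp: reaches_def in_arcs)
  qed (use k in auto)
qed (auto intro: reaches_snoc)

lemma reaches_Suc_cons:
  "reaches D (Suc n) a b \<longleftrightarrow> a = b \<or> (\<exists>c e. (a, e, c) \<in> D \<and> reaches D n c b)"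
  using reaches_Suc_snoc[of "reverse D" n b a] by auto

lemma reaches_first_entry:
  assumes "reaches D n v x" "v \<notin> X" "x \<in> X"
  shows "\<exists>m w f y. Suc m \<le> n \<and> reaches (outside D X) m v w \<and> w \<notin> X \<and> y \<in> X \<and> (w, f, y) \<in> D"
  using assms
proof (induction n arbitrary: v)
  case 0
  then show ?case by (simp add: reaches_0)
next
  case (Suc n)
  then obtain z e where z: "(v, e, z) \<in> D" "reaches D n z x"
    unfolding reaches_Suc_cons by blast
  show ?case
  proof (cases "z \<in> X")
    case True
    then show ?thesis using z Suc.prems
      by (intro exI[of _ 0] exI[of _ v] exI[of _ e] exI[of _ z]) auto
  next
    case False
    then obtain m w f y where "Suc m \<le> n" "reaches (outside D X) m z w" "w \<notin> X" "y \<in> X" "(w, f, y) \<in> D"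
      using Suc.IH[OF z(2) False Suc.prems(3)] by blast
    moreover have "(v, e, z) \<in> outside D X" using z Suc.prems False by simp
    ultimately show ?thesis by (meson Suc_le_mono reaches_cons)
  qed
qed

lemma reaches_last_exit:
  assumes "reaches D n x v" "v \<notin> X" "x \<in> X"
  shows "\<exists>m w f y. Suc m \<le> n \<and> reaches (outside D X) m w v \<and> w \<notin> X \<and> y \<in> X \<and> (y, f, w) \<in> D"
  using reaches_first_entry[of "reverse D" n v x X] assms
  by (simp flip: reverse_outside)

text \<open>Every vertex that can reach \<open>A\<close> chooses one dart towards a vertex closer to
  \<open>A\<close>. The distance drops by one along each chosen dart, so no edge is chosen in both
  directions. A vertex of \<open>Y\<close> met after \<open>j\<close> steps from \<open>v\<close>
  has distance \<open>Suc k\<close>, and \<open>j + Suc k\<close> is the distance of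
  \<open>v\<close>, which is at most \<open>n\<close>. The lemma serves twice, the second time in a
  reversed graph to produce an out-tree.\<close>

lemma in_tree_exists:
  assumes ends: "edge_ends_unique R"
    and N: "\<And>v. v \<in> N \<Longrightarrow> v \<notin> A \<and> (\<exists>a\<in>A. reaches R n v a)"
  obtains T Y where "T \<subseteq> R" "oriented T" "N \<subseteq> Y" "Y \<inter> A = {}"
    "\<And>y e z. (y, e, z) \<in> T \<Longrightarrow> y \<in> Y \<and> z \<in> Y \<union> A"
    "\<And>y. y \<in> Y \<Longrightarrow> \<exists>v\<in>N. \<exists>a\<in>A. \<exists>j k. j + k < n \<and> reaches T j v y \<and> reaches T (Suc k) y a"
proof -
  define conn where "conn y \<longleftrightarrow> (\<exists>k. \<exists>a\<in>A. reaches R k y a)" for y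
  define t where "t y = (LEAST k. \<exists>a\<in>A. reaches R k y a)" for y
  have t_le: "t y \<le> k" if "reaches R k y a" "a \<in> A" for k y a
    unfolding t_def using that by (intro Least_le) auto
  have t_ex: "\<exists>a\<in>A. reaches R (t y) y a" if "conn y" for y
    unfolding t_def using that unfolding conn_def by (rule LeastI_ex)
  have step: "\<exists>e z. (y, e, z) \<in> R \<and> conn z \<and> t y = Suc (t z)" if "conn y" "y \<notin> A" for y
  proof -
    obtain a where a: "a \<in> A" "reaches R (t y) y a" using t_ex[OF \<open>conn y\<close>] by blast
    then have "t y \<noteq> 0" using that by (auto simp: reaches_0 intro: gr0I)
    then obtain k where k: "t y = Suc k" by (cases "t y") auto
    then obtain e z where z: "(y, e, z) \<in> R" "reaches R k z a"
      using a \<open>y \<notin> A\<close> unfolding reaches_Suc_cons[of R k y a] k by auto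
    have "conn z" using z a unfolding conn_def by blast
    then obtain b where "b \<in> A" "reaches R (t z) z b" using t_ex by blast
    then have "t y \<le> Suc (t z)" using t_le reaches_cons[OF z(1)] by blast
    moreover have "t z \<le> k" using t_le z a by blast
    ultimately show ?thesis using z \<open>conn z\<close> k by auto
  qed
  then obtain f g where fg: "\<And>y. conn y \<Longrightarrow> y \<notin> A \<Longrightarrow>
      (y, f y, g y) \<in> R \<and> conn (g y) \<and> t y = Suc (t (g y))"
    by metis
  \<comment> \<open>The vertices met when \<open>g\<close> is followed from \<open>N\<close> until
    \<open>A\<close> is hit. Since \<open>g\<close> is unspecified where \<open>conn\<close> fails,
    \<open>conn y\<close> is required explicitly.\<close>
  define Y where "Y = {y. y \<notin> A \<and> conn y \<and> (\<exists>v\<in>N. \<exists>k. (v, y) \<in> {(a, g a) | a. a \<notin> A} ^^ k)}"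
  define T where "T = {(y, f y, g y) | y. y \<in> Y}"
  have Y: "y \<notin> A" "conn y" if "y \<in> Y" for y
    using that by (auto simp: Y_def)
  have gY: "g y \<in> Y" if "y \<in> Y" "g y \<notin> A" for y
  proof -
    obtain v k where "v \<in> N" "(v, y) \<in> {(a, g a) | a. a \<notin> A} ^^ k"
      using \<open>y \<in> Y\<close> by (auto simp: Y_def)
    then have "(v, g y) \<in> {(a, g a) | a. a \<notin> A} ^^ Suc k"
      using Y[OF \<open>y \<in> Y\<close>] by auto
    then show ?thesis using fg Y[OF \<open>y \<in> Y\<close>] that \<open>v \<in> N\<close> unfolding Y_def by blast
  qed
  have NY: "N \<subseteq> Y"
  proof
    fix v assume v: "v \<in> N"
    then have "conn v" "v \<notin> A" using N unfolding conn_def by blast+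
    moreover have "(v, v) \<in> {(a, g a) | a. a \<notin> A} ^^ 0" by simp
    ultimately show "v \<in> Y" using v unfolding Y_def by blast
  qed
  have to_A: "\<exists>a\<in>A. reaches T (t y) y a" if "y \<in> Y" for y
    using that
  proof (induction "t y" arbitrary: y)
    case 0
    then show ?case using fg Y by force
  next
    case (Suc k)
    have d: "(y, f y, g y) \<in> T" using Suc.prems by (auto simp: T_def)
    have k: "t (g y) = k" using fg Y Suc by force
    show ?case
    proof (cases "g y \<in> A")
      case True
      then show ?thesis using reaches_snoc[OF reaches_refl d] Suc(2)
        by (metis Suc_le_mono order_refl reaches_mono zero_le)
    next
      case False
      then show ?thesis using Suc.hyps(1)[of "g y"] gY[OF Suc.prems] k reaches_cons[OF d] Suc(2) by metis
    qed
  qed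
  have from_N: "reaches T k v y \<and> t v = k + t y"
    if "v \<in> N" "(v, y) \<in> {(a, g a) | a. a \<notin> A} ^^ k" "y \<in> Y" for v y k
    using that
  proof (induction k arbitrary: y)
    case (Suc k)
    then obtain z where z: "(v, z) \<in> {(a, g a) | a. a \<notin> A} ^^ k" "z \<notin> A" "y = g z"
      by auto
    have "conn z"
      using z(1,2)
    proof (induction k arbitrary: z)
      case 0
      then show ?case using NY Suc.prems Y by auto
    next
      case (Suc k)
      then show ?case using fg by auto
    qed
    then have "z \<in> Y" using z \<open>v \<in> N\<close> unfolding Y_def by blast
    then have "reaches T k v z \<and> t v = k + t z" using Suc.IH Suc.prems z by blast
    moreover have "(z, f z, y) \<in> T" using \<open>z \<in> Y\<close> z by (auto simp: T_def)
    ultimately show ?case using fg[OF \<open>conn z\<close> \<open>z \<notin> A\<close>] z by (auto intro: reaches_snoc)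
  qed auto
  show thesis
  proof
    show "T \<subseteq> R" using fg Y by (auto simp: T_def)
    show "oriented T"
      unfolding oriented_def
    proof (intro allI impI)
      fix a e b a' b' assume T: "(a, e, b) \<in> T" "(a', e, b') \<in> T"
      then have ab: "a \<in> Y" "b = g a" "a' \<in> Y" "b' = g a'" by (auto simp: T_def)
      have "a' = a \<and> b' = b \<or> a' = b \<and> b' = a"
        using edge_ends_uniqueD[OF ends] T \<open>T \<subseteq> R\<close> by blast
      moreover have "\<not> (a' = b \<and> b' = a)"
      proof
        assume "a' = b \<and> b' = a"
        then have "t a = Suc (t a')" "t a' = Suc (t a)" using fg Y ab by metis+
        then show False by simp
      qed
      ultimately show "a' = a \<and> b' = b" by blast
    qed
    show "N \<subseteq> Y" by (rule NY)
    show "Y \<inter> A = {}" using Y by blast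
    show "y \<in> Y \<and> z \<in> Y \<union> A" if "(y, e, z) \<in> T" for y e z
      using that gY by (auto simp: T_def)
    show "\<exists>v\<in>N. \<exists>a\<in>A. \<exists>j k. j + k < n \<and> reaches T j v y \<and> reaches T (Suc k) y a" if y: "y \<in> Y" for y
    proof -
      obtain v k where v: "v \<in> N" "(v, y) \<in> {(a, g a) | a. a \<notin> A} ^^ k"
        using y by (auto simp: Y_def)
      then have k: "reaches T k v y" "t v = k + t y" using from_N y by blast+
      have "t v \<le> n" using N v(1) t_le by blast
      moreover obtain i where i: "t y = Suc i" using fg Y[OF y] by blast
      moreover obtain a where "a \<in> A" "reaches T (Suc i) y a" using to_A[OF y] i by auto
      ultimately show ?thesis using k v(1) by (metis add_Suc_right less_eq_Suc_le)
    qed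
  qed
qed

section \<open>Absorbing the neighbours of the core\<close>

text \<open>The set \<open>X\<close> plays the role of a single contracted vertex. An ear at \<open>X\<close> consists of a
  crossing edge and a walk of length at most \<open>l\<close> avoiding it, so it is a cycle of length at most
  \<open>l + 1\<close> through that vertex; an undirected crossing edge may be usable in one direction only.\<close>

definition has_ears :: "('v \<times> 'e \<times> 'v) set \<Rightarrow> 'v set \<Rightarrow> nat \<Rightarrow> bool" where
  "has_ears G X l \<longleftrightarrow> (\<forall>a e b. (a, e, b) \<in> G \<longrightarrow> (a \<in> X) \<noteq> (b \<in> X) \<longrightarrow>
     (\<exists>p q. (p, e, q) \<in> G \<and>
       (p \<in> X \<and> q \<notin> X \<and> (\<exists>x\<in>X. reaches (delete G e) l q x) \<or>
        p \<notin> X \<and> q \<in> X \<and> (\<exists>x\<in>X. reaches (delete G e) l x p))))"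

text \<open>\<open>P\<close> and \<open>Q\<close> are kept apart because an expansion charges them
  differently. \<open>D\<close> need not contain a dart for every edge inside \<open>X\<close>; the
  missing edges are oriented arbitrarily at the end.\<close>

definition core :: "('v \<times> 'e \<times> 'v) set \<Rightarrow> 'v \<Rightarrow> 'v set \<Rightarrow> ('v \<times> 'e \<times> 'v) set \<Rightarrow> nat \<Rightarrow> nat \<Rightarrow> bool" where
  "core G c X D P Q \<longleftrightarrow> D \<subseteq> G \<and> oriented D \<and> (\<forall>a e b. (a, e, b) \<in> D \<longrightarrow> a \<in> X \<and> b \<in> X) \<and>
     (\<forall>x\<in>X. reaches D P c x \<and> reaches D Q x c)"

lemma has_ears_reverse: 
  assumes "has_ears G X l"
  shows "has_ears (reverse G) X l"
  unfolding has_ears_def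
proof (intro allI impI)
  fix a e b assume "(a, e, b) \<in> reverse G" "(a \<in> X) \<noteq> (b \<in> X)"
  then have "(b, e, a) \<in> G" "(b \<in> X) \<noteq> (a \<in> X)" by auto
  then obtain p q where "(p, e, q) \<in> G" 
    "p \<in> X \<and> q \<notin> X \<and> (\<exists>x\<in>X. reaches (delete G e) l q x) \<or>
     p \<notin> X \<and> q \<in> X \<and> (\<exists>x\<in>X. reaches (delete G e) l x p)"
    using assms unfolding has_ears_def by blast
  then show "\<exists>p q. (p, e, q) \<in> reverse G \<and>
       (p \<in> X \<and> q \<notin> X \<and> (\<exists>x\<in>X. reaches (delete (reverse G) e) l q x) \<or>
        p \<notin> X \<and> q \<in> X \<and> (\<exists>x\<in>X. reaches (delete (reverse G) e) l x p))"
    by (intro exI[of _ q] exI[of _ p]) (auto simp flip: reverse_delete)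
qed

lemma core_reverse: "core G c X D P Q \<Longrightarrow> core (reverse G) c X (reverse D) Q P"
  unfolding core_def by (auto intro: oriented_reverse simp: reverse_mono)

text \<open>First the undirected crossing edges are split into inward ones (\<open>F\<close>) and outward ones, such that
  every outward edge has a short way back to \<open>X\<close>; the shortest ways back form the in-tree \<open>T\<close>
  on \<open>Y\<close>. Edges that admit an ear only in the outward direction are never put into \<open>F\<close>, and \<open>F\<close> is
  minimal, so that turning an edge \<open>f \<in> F\<close> outward destroys a way back: either its own, or one
  through \<open>f\<close>, and then the outer end of \<open>f\<close> lies in \<open>Y\<close>. It follows that every inward edge not
  yet reached can be reached from \<open>Y\<close> by a short walk outside \<open>X\<close>; the out-tree of these walks
  is \<open>S\<close>.\<close>

lemma expand_core:
  assumes ends: "edge_ends_unique G"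
    and fin: "finite {e. \<exists>a b. (a, e, b) \<in> G}"
    and core: "core G c X D P Q"
    and ears: "has_ears G X (Suc l)"
  obtains X' D' where "X \<subseteq> X'" "core G c X' D' (P + 2 * l + 1) (Q + l + 1)"
    "\<And>a e b. (a, e, b) \<in> G \<Longrightarrow> a \<in> X \<or> b \<in> X \<Longrightarrow> a \<in> X' \<and> b \<in> X'"
proof -
  have D: "D \<subseteq> G" "oriented D" "\<And>a e b. (a, e, b) \<in> D \<Longrightarrow> a \<in> X \<and> b \<in> X"
    "\<And>x. x \<in> X \<Longrightarrow> reaches D P c x" "\<And>x. x \<in> X \<Longrightarrow> reaches D Q x c"
    using core unfolding core_def by auto
  \<comment> \<open>Crossing edges available in both directions: exactly those for which a choice
    has to be made.\<close>
  define U where "U = {e. \<exists>x v. x \<in> X \<and> v \<notin> X \<and> (x, e, v) \<in> G \<and> (v, e, x) \<in> G}"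
  have U: "e \<in> U" if "(x, e, v) \<in> G" "(v, e, x) \<in> G" "x \<in> X" "v \<notin> X" for x e v
    using that by (auto simp: U_def)
  define in_ok where "in_ok e \<longleftrightarrow>
    (\<exists>v x y. v \<notin> X \<and> x \<in> X \<and> y \<in> X \<and> (v, e, x) \<in> G \<and> reaches (delete G e) (Suc l) y v)" for e
  define out_ok where "out_ok e \<longleftrightarrow>
    (\<exists>v x y. v \<notin> X \<and> x \<in> X \<and> y \<in> X \<and> (x, e, v) \<in> G \<and> reaches (delete G e) (Suc l) v y)" for e
  have ok: "in_ok e \<or> out_ok e" if "(a, e, b) \<in> G" "(a \<in> X) \<noteq> (b \<in> X)" for a e b
    using ears that unfolding has_ears_def in_ok_def out_ok_def by blast
  have crossing: "x' = x \<and> v' = v" 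
    if "(x, e, v) \<in> G \<or> (v, e, x) \<in> G" "(x', e, v') \<in> G \<or> (v', e, x') \<in> G" "x \<in> X" "v \<notin> X" "x' \<in> X" "v' \<notin> X"
    for x e v x' v'
    using that edge_ends_uniqueD[OF ends] by metis
  \<comment> \<open>The darts allowed on a way back once \<open>F\<close> is turned inward.\<close>
  define R where "R F = outside G X \<union>
    {(v, e, x). (v, e, x) \<in> G \<and> v \<notin> X \<and> x \<in> X \<and> (e \<in> F \<or> e \<notin> U)}" for F
  define valid where "valid F \<longleftrightarrow> F \<subseteq> U \<and> (\<forall>e\<in>F. in_ok e) \<and>
    (\<forall>x e v. (x, e, v) \<in> G \<longrightarrow> x \<in> X \<longrightarrow> v \<notin> X \<longrightarrow> e \<notin> F \<longrightarrow> (\<exists>y\<in>X. reaches (R F) (Suc l) v y))" for F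
  have R_sub: "R F \<subseteq> G" for F by (auto simp: R_def)
  have "valid {e \<in> U. in_ok e}" (is "valid ?F")
    unfolding valid_def
  proof (intro conjI allI impI)
    fix x e v assume e: "(x, e, v) \<in> G" "x \<in> X" "v \<notin> X" "e \<notin> ?F"
    have "out_ok e"
    proof (rule ccontr)
      assume "\<not> out_ok e"
      then have "in_ok e" using ok e by blast
      then obtain v' x' where "v' \<notin> X" "x' \<in> X" "(v', e, x') \<in> G" by (auto simp: in_ok_def)
      then have "(v, e, x) \<in> G" using crossing e by metis
      then show False using U e \<open>in_ok e\<close> by blast
    qed
    then obtain v' x' y where "v' \<notin> X" "x' \<in> X" "y \<in> X" "(x', e, v') \<in> G" "reaches (delete G e) (Suc l) v' y"
      by (auto simp: out_ok_def)
    then have y: "reaches (delete G e) (Suc l) v y" "y \<in> X"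
      using crossing[of x e v x' v'] e by auto
    then obtain m w f z where w: "Suc m \<le> Suc l" "reaches (outside (delete G e) X) m v w" "w \<notin> X" "z \<in> X"
      "(w, f, z) \<in> delete G e"
      using reaches_first_entry[OF y(1) \<open>v \<notin> X\<close> y(2)] by blast
    \<comment> \<open>If the way back enters \<open>X\<close> by an undirected edge
      \<open>f\<close>, then \<open>e\<close> followed by the way back up to \<open>w\<close> is a
      walk from \<open>X\<close> that avoids \<open>f\<close>, so \<open>f\<close> passes
      \<open>in_ok\<close> as well.\<close>
    have "f \<in> ?F" if "f \<in> U"
    proof -
      have "(x, e, v) \<in> delete G f" using e w by auto
      moreover have "outside (delete G e) X \<subseteq> delete G f"
      proof
        fix d assume "d \<in> outside (delete G e) X"
        then obtain a g b where d: "d = (a, g, b)" "(a, g, b) \<in> G" "a \<notin> X" "b \<notin> X"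
          by (cases d) auto
        then have "g \<noteq> f" using w edge_ends_uniqueD[OF ends, of a g b w z] by auto
        then show "d \<in> delete G f" using d by simp
      qed
      ultimately have "reaches (delete G f) (Suc l) x w"
        using reaches_cons_le[OF _ reaches_mono[OF w(2) _ order_refl] w(1)] by blast
      then show ?thesis using that w e unfolding in_ok_def by auto
    qed
    then have 1: "(w, f, z) \<in> R ?F" using w unfolding R_def by auto
    have 2: "reaches (R ?F) m v w"
      by (rule reaches_mono[OF w(2) _ order_refl]) (auto simp: R_def)
    show "\<exists>y\<in>X. reaches (R ?F) (Suc l) v y"
      using reaches_snoc_le[OF 2 1 w(1)] \<open>z \<in> X\<close> ..
  qed auto
  moreover have "finite {F. valid F}"
  proof (rule finite_subset)
    show "{F. valid F} \<subseteq> Pow {e. \<exists>a b. (a, e, b) \<in> G}"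
      unfolding valid_def U_def by blast
  qed (use fin in auto)
  ultimately have "\<exists>F\<in>{F. valid F}. \<forall>F'\<in>{F. valid F}. F' \<subseteq> F \<longrightarrow> F = F'"
    by (intro finite_has_minimal) blast+
  then obtain F where F: "valid F" and F_min: "\<And>F'. valid F' \<Longrightarrow> F' \<subseteq> F \<Longrightarrow> F' = F"
    by blast
  define N where "N = {v. v \<notin> X \<and> (\<exists>x\<in>X. \<exists>e. (x, e, v) \<in> G \<and> e \<notin> F)}"
  define T0 where "T0 = {(x, e, v). (x, e, v) \<in> G \<and> x \<in> X \<and> v \<notin> X \<and> e \<notin> F}"
  have ends_R: "edge_ends_unique (R F)" using edge_ends_unique_subset[OF ends R_sub] .
  have N: "v \<notin> X \<and> (\<exists>a\<in>X. reaches (R F) (Suc l) v a)" if "v \<in> N" for v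
    using that F unfolding N_def valid_def by blast
  from in_tree_exists[OF ends_R N] obtain T Y where T: "T \<subseteq> R F" "oriented T" "N \<subseteq> Y" "Y \<inter> X = {}"
    "\<And>y e z. (y, e, z) \<in> T \<Longrightarrow> y \<in> Y \<and> z \<in> Y \<union> X"
    "\<And>y. y \<in> Y \<Longrightarrow> \<exists>v\<in>N. \<exists>a\<in>X. \<exists>j k. j + k < Suc l \<and> reaches T j v y \<and> reaches T (Suc k) y a"
    by metis
  define R2 where "R2 = reverse (outside G X)"
  have ends_R2: "edge_ends_unique R2"
    unfolding R2_def by (rule edge_ends_unique_reverse, rule edge_ends_unique_subset[OF ends]) auto
  define M where "M = {v. v \<notin> X \<and> v \<notin> Y \<and> (\<exists>x\<in>X. \<exists>e. (v, e, x) \<in> G \<and> (e \<in> F \<or> e \<notin> U))}"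
  define T3 where "T3 = {(v, e, x). (v, e, x) \<in> G \<and> v \<in> M \<and> x \<in> X \<and> (e \<in> F \<or> e \<notin> U)}"
  have M: "v \<notin> Y \<and> (\<exists>y\<in>Y. reaches R2 l v y)" if "v \<in> M" for v
  proof -
    obtain x e where e: "x \<in> X" "(v, e, x) \<in> G" "e \<in> F \<or> e \<notin> U" and v: "v \<notin> X" "v \<notin> Y"
      using \<open>v \<in> M\<close> by (auto simp: M_def)
    have "in_ok e"
    proof (rule ccontr)
      assume "\<not> in_ok e"
      then have "out_ok e" "e \<notin> F" using ok e v F unfolding valid_def by blast+
      then obtain v' x' where "v' \<notin> X" "x' \<in> X" "(x', e, v') \<in> G" by (auto simp: out_ok_def)
      then have "(x, e, v) \<in> G" using crossing e v by metis
      then show False using U e v \<open>e \<notin> F\<close> by blast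
    qed
    then obtain v' x' y where "v' \<notin> X" "x' \<in> X" "y \<in> X" "(v', e, x') \<in> G" "reaches (delete G e) (Suc l) y v'"
      by (auto simp: in_ok_def)
    then have y: "reaches (delete G e) (Suc l) y v" "y \<in> X"
      using crossing[of x e v x' v'] e v by auto
    then obtain m w f z where w: "m \<le> l" "reaches (outside (delete G e) X) m w v" "w \<notin> X" "z \<in> X"
      "(z, f, w) \<in> G" "f \<noteq> e"
      using reaches_last_exit[of "delete G e" "Suc l" y v X] y v by auto
    have wv: "reaches (outside G X) m w v"
      by (rule reaches_mono[OF w(2) _ order_refl]) auto
    have "w \<in> Y"
    proof (cases "f \<in> F")
      case False
      then show ?thesis using w T unfolding N_def by blast
    next
      case True
      show ?thesis
      proof (rule ccontr)
        assume "w \<notin> Y"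
        \<comment> \<open>Turned outward, \<open>f\<close> has its own way back, from
          \<open>w\<close> along the ear to \<open>v\<close> and then through \<open>e\<close>,
          which remains inward. Every other way back can be taken along \<open>T\<close>, which does
          not use \<open>f\<close> to enter \<open>X\<close> because \<open>w\<close> is not in
          \<open>Y\<close>. This contradicts the minimality of \<open>F\<close>.\<close>
        have "valid (F - {f})"
          unfolding valid_def
        proof (intro conjI allI impI)
          fix x2 g v2 assume g: "(x2, g, v2) \<in> G" "x2 \<in> X" "v2 \<notin> X" "g \<notin> F - {f}"
          show "\<exists>y\<in>X. reaches (R (F - {f})) (Suc l) v2 y"
          proof (cases "g = f")
            case True
            then have "v2 = w" using crossing g w by metis
            moreover have "reaches (R (F - {f})) m w v"
              by (rule reaches_mono[OF wv _ order_refl]) (auto simp: R_def)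
            moreover have "(v, e, x) \<in> R (F - {f})" using e v w unfolding R_def by auto
            ultimately show ?thesis using reaches_snoc_le[of _ m w v e x "Suc l"] e(1) w(1) by auto
          next
            case False
            then have "v2 \<in> N" using g unfolding N_def by blast
            then obtain v3 a j k where "a \<in> X" "reaches T (Suc k) v2 a" "j + k < Suc l"
              using T(3,6) by blast
            moreover have "T \<subseteq> R (F - {f})"
            proof
              fix d assume d: "d \<in> T"
              obtain y h z' where yz: "d = (y, h, z')" by (cases d)
              have "y \<in> Y" "d \<in> R F" using d T yz by blast+
              moreover have "h \<noteq> f" if "z' \<in> X"
              proof
                assume "h = f"
                then have "y = w" using crossing[of z' f y z w] that w \<open>d \<in> R F\<close> yz T(4) \<open>y \<in> Y\<close> R_sub
                  by blast
                then show False using \<open>y \<in> Y\<close> \<open>w \<notin> Y\<close> by blast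
              qed
              ultimately show "d \<in> R (F - {f})" using yz unfolding R_def by auto
            qed
            ultimately show ?thesis using reaches_mono[of T "Suc k" v2 a _ "Suc l"] by auto
          qed
        qed (use F in \<open>auto simp: valid_def\<close>)
        then show False using F_min[of "F - {f}"] True by blast
      qed
    qed
    moreover have "reaches R2 l v w" unfolding R2_def using reaches_mono[OF wv] w(1) by simp
    ultimately show ?thesis using v by blast
  qed
  from in_tree_exists[OF ends_R2 M] obtain S Z where S: "S \<subseteq> R2" "oriented S" "M \<subseteq> Z" "Z \<inter> Y = {}"
    "\<And>y e z. (y, e, z) \<in> S \<Longrightarrow> y \<in> Z \<and> z \<in> Z \<union> Y"
    "\<And>y. y \<in> Z \<Longrightarrow> \<exists>v\<in>M. \<exists>a\<in>Y. \<exists>j k. j + k < l \<and> reaches S j v y \<and> reaches S (Suc k) y a"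
    by metis
  define D' where "D' = D \<union> T0 \<union> T \<union> reverse S \<union> T3"
  have S_out: "(a, e, b) \<in> G \<and> a \<notin> X \<and> b \<notin> X" if "(b, e, a) \<in> S" for a e b
    using that S(1) unfolding R2_def by auto
  have ZX: "y \<notin> X" if "y \<in> Z" for y
  proof
    assume "y \<in> X"
    obtain a k where "a \<in> Y" "reaches S (Suc k) y a" using S(6)[OF \<open>y \<in> Z\<close>] by blast
    then show False
      using S_out \<open>y \<in> X\<close> \<open>y \<in> Z\<close> S(4) unfolding reaches_Suc_cons by blast
  qed
  have U_sym: "(v, e, x) \<in> G" if "(x, e, v) \<in> G" "e \<in> U" for x e v
  proof -
    obtain x' v' where "(x', e, v') \<in> G" "(v', e, x') \<in> G" using \<open>e \<in> U\<close> by (auto simp: U_def)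
    then show ?thesis using edge_ends_uniqueD[OF ends _ that(1)] by blast
  qed
  have FU: "F \<subseteq> U" using F by (simp add: valid_def)
  \<comment> \<open>The disjoint sets \<open>X\<close>, \<open>Y\<close>, \<open>Z\<close>
    containing the ends separate the classes of darts. Across classes, opposite directions of one
    edge are conceivable only for an outward dart of \<open>T0\<close> and a dart of
    \<open>T\<close> entering \<open>X\<close>.\<close>
  have D'_cases: "(a, e, b) \<in> D \<and> a \<in> X \<and> b \<in> X \<or> (a, e, b) \<in> T \<and> a \<in> Y \<and> b \<in> Y \<union> X \<or>
      (b, e, a) \<in> S \<and> b \<in> Z \<and> a \<in> Z \<union> Y \<or> a \<in> X \<and> b \<in> Y \<and> e \<notin> F \<or> a \<in> Z \<and> b \<in> X"
    if "(a, e, b) \<in> D'" for a e b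
  proof -
    consider "(a, e, b) \<in> D" | "(a, e, b) \<in> T0" | "(a, e, b) \<in> T" | "(b, e, a) \<in> S" | "(a, e, b) \<in> T3"
      using \<open>(a, e, b) \<in> D'\<close> unfolding D'_def by auto
    then show ?thesis
    proof cases
      case 2
      then have "b \<in> N" "a \<in> X" "e \<notin> F" unfolding T0_def N_def by auto
      then show ?thesis using T(3) by blast
    next
      case 5
      then have "a \<in> M" "b \<in> X" unfolding T3_def by auto
      then show ?thesis using S(3) by blast
    qed (use D(3) T(5) S(5) in blast)+
  qed
  have "D' \<subseteq> G"
    unfolding D'_def T0_def T3_def using D(1) T(1) R_sub S_out by auto
  have disj: "X \<inter> Y = {}" "X \<inter> Z = {}" "Y \<inter> Z = {}" using T(4) S(4) ZX by blast+
  have "oriented D'"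
  proof (rule orientedI[OF edge_ends_unique_subset[OF ends \<open>D' \<subseteq> G\<close>]])
    fix a e b assume ab: "(a, e, b) \<in> D'" "(b, e, a) \<in> D'"
    \<comment> \<open>A dart of \<open>T\<close> entering \<open>X\<close> by an edge outside
      \<open>F\<close> lies in \<open>R F\<close>, so its edge is not in \<open>U\<close> and has no
      opposite dart.\<close>
    have *: False if "(p, e, q) \<in> T" "p \<in> Y" "q \<in> X" "e \<notin> F" "(q, e, p) \<in> D'" for p q
    proof -
      have "(p, e, q) \<in> R F" using that T by blast
      then have "e \<notin> U" "(p, e, q) \<in> G" using that unfolding R_def by auto
      then show False using that \<open>D' \<subseteq> G\<close> U disj(1) by blast
    qed
    consider "(a, e, b) \<in> D" "(b, e, a) \<in> D" | "(a, e, b) \<in> T" "(b, e, a) \<in> T"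
      | "(a, e, b) \<in> S" "(b, e, a) \<in> S"
      using D'_cases[OF ab(1)] D'_cases[OF ab(2)] disj *[of a b] *[of b a] ab by blast
    then show "a = b"
      using D(2) T(2) S(2) unfolding oriented_def by cases blast+
  qed
  have sub: "D \<subseteq> D'" "T \<subseteq> D'" "reverse S \<subseteq> D'" by (auto simp: D'_def)
  have X_dist: "reaches D' P c x" "reaches D' Q x c" if "x \<in> X" for x
    using D(4,5)[OF that] sub(1) by (blast intro: reaches_mono)+
  have Y_dist: "reaches D' (P + l + 1) c y" "reaches D' (Q + l + 1) y c" if y: "y \<in> Y" for y
  proof -
    obtain v a j k where v: "v \<in> N" "a \<in> X" "j + k < Suc l" "reaches T j v y" "reaches T (Suc k) y a"
      using T(6)[OF y] by blast
    then obtain x e where x: "x \<in> X" "(x, e, v) \<in> T0" by (auto simp: N_def T0_def)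
    then have xv: "(x, e, v) \<in> D'" by (auto simp: D'_def)
    have "reaches D' (P + Suc j) c y"
      by (rule reaches_trans[OF X_dist(1)[OF x(1)] reaches_cons[OF xv reaches_mono[OF v(4) sub(2) order_refl]]])
    then show "reaches D' (P + l + 1) c y" by (rule reaches_mono) (use v in auto)
    have "reaches D' (Suc k + Q) y c"
      by (rule reaches_trans[OF reaches_mono[OF v(5) sub(2) order_refl] X_dist(2)[OF v(2)]])
    then show "reaches D' (Q + l + 1) y c" by (rule reaches_mono) (use v in auto)
  qed
  \<comment> \<open>Outward, \<open>Suc k \<le> l\<close> steps are added to the cost of a vertex of
    \<open>Y\<close>. Homeward, the out-tree is followed onwards to a vertex of \<open>M\<close>,
    from which a single edge enters \<open>X\<close>.\<close>
  have Z_dist: "reaches D' (P + 2 * l + 1) c z" "reaches D' (Q + l + 1) z c" if z: "z \<in> Z" for z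
  proof -
    obtain v a j k where v: "v \<in> M" "a \<in> Y" "j + k < l" "reaches S j v z" "reaches S (Suc k) z a"
      using S(6)[OF z] by blast
    have "reaches (reverse S) j z v" "reaches (reverse S) (Suc k) a z" using v by simp_all
    then have S': "reaches D' j z v" "reaches D' (Suc k) a z"
      using reaches_mono[OF _ sub(3) order_refl] by blast+
    have "reaches D' ((P + l + 1) + Suc k) c z"
      using Y_dist(1)[OF v(2)] S'(2) by (rule reaches_trans)
    then show "reaches D' (P + 2 * l + 1) c z" by (rule reaches_mono) (use v in auto)
    obtain x e where x: "x \<in> X" "(v, e, x) \<in> T3" using v(1) by (auto simp: M_def T3_def)
    then have vx: "(v, e, x) \<in> D'" by (auto simp: D'_def)
    have "reaches D' (j + Suc Q) z c"
      by (rule reaches_trans[OF S'(1) reaches_cons[OF vx X_dist(2)[OF x(1)]]])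
    then show "reaches D' (Q + l + 1) z c" by (rule reaches_mono) (use v in auto)
  qed
  show thesis
  proof (rule that[of "X \<union> Y \<union> Z" D'])
    have "a \<in> X \<union> Y \<union> Z \<and> b \<in> X \<union> Y \<union> Z" if "(a, e, b) \<in> D'" for a e b
      using D'_cases[OF that] by blast
    moreover have "reaches D' (P + 2 * l + 1) c x \<and> reaches D' (Q + l + 1) x c"
      if "x \<in> X \<union> Y \<union> Z" for x
      using that X_dist[of x] Y_dist[of x] Z_dist[of x]
        reaches_mono[OF _ order_refl, of D' P c x "P + 2 * l + 1"]
        reaches_mono[OF _ order_refl, of D' Q x c "Q + l + 1"]
        reaches_mono[OF _ order_refl, of D' "P + l + 1" c x "P + 2 * l + 1"]
      by auto
    ultimately show "core G c (X \<union> Y \<union> Z) D' (P + 2 * l + 1) (Q + l + 1)"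
      unfolding core_def using \<open>D' \<subseteq> G\<close> \<open>oriented D'\<close> by blast
    have nbr: "v \<in> X \<union> Y \<union> Z" if "(x, e, v) \<in> G \<or> (v, e, x) \<in> G" "x \<in> X" for x e v
    proof (cases "v \<in> X \<or> v \<in> N")
      case False
      \<comment> \<open>If every edge from \<open>x\<close> to \<open>v\<close> lies in
        \<open>F\<close>, such an edge is undirected, so in any case an edge turned inward joins
        \<open>v\<close> to \<open>x\<close>.\<close>
      then have e: "e \<in> F" if "(x, e, v) \<in> G" using that \<open>x \<in> X\<close> unfolding N_def by blast
      then have "(v, e, x) \<in> G" using that U_sym FU by blast
      moreover have "e \<in> F \<or> e \<notin> U" using e U_sym[OF \<open>(v, e, x) \<in> G\<close>] by blast
      ultimately have "v \<in> Y \<or> v \<in> M" using False \<open>x \<in> X\<close> unfolding M_def by blast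
      then show ?thesis using S(3) by blast
    qed (use T(3) in blast)
    show "a \<in> X \<union> Y \<union> Z \<and> b \<in> X \<union> Y \<union> Z" if "(a, e, b) \<in> G" "a \<in> X \<or> b \<in> X" for a e b
      using that nbr by blast
  qed auto
qed

section \<open>Lengths of ears\<close>

text \<open>One traversal of \<open>e\<close> suffices: a walk that traverses \<open>e\<close> again
  in the same direction can be cut to end at \<open>q\<close> after the first traversal, and one
  that traverses it backwards has returned to \<open>p\<close>, which was reached without
  \<open>e\<close>.\<close>

lemma reaches_delete_or_split:
  assumes ends: "edge_ends_unique G" and "reaches G n x y"
  shows "reaches (delete G e) n x y \<or>
    (\<exists>p q k l. (p, e, q) \<in> G \<and> k + l < n \<and> reaches (delete G e) k x p \<and> reaches (delete G e) l q y)"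
  using assms(2)
proof (induction n arbitrary: y)
  case 0
  then show ?case by (simp add: reaches_0)
next
  case (Suc n)
  then consider "x = y" | z f where "reaches G n x z" "(z, f, y) \<in> G"
    unfolding reaches_Suc_snoc by blast
  then show ?case
  proof cases
    case 2
    from Suc.IH[OF 2(1)] show ?thesis
    proof
      assume z: "reaches (delete G e) n x z"
      show ?thesis
      proof (cases "f = e")
        case True
        then show ?thesis using z 2(2)
          by (intro disjI2 exI[of _ z] exI[of _ y] exI[of _ n] exI[of _ 0]) auto
      next
        case False
        then show ?thesis using z 2(2) reaches_snoc[of "delete G e" n x z f y] by auto
      qed
    next
      assume "\<exists>p q k l. (p, e, q) \<in> G \<and> k + l < n \<and> reaches (delete G e) k x p \<and> reaches (delete G e) l q z"
      then obtain p q k l where pq: "(p, e, q) \<in> G" "k + l < n" "reaches (delete G e) k x p"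
        "reaches (delete G e) l q z" by blast
      show ?thesis
      proof (cases "f = e")
        case True
        then consider "y = q" | "y = p" using edge_ends_uniqueD[OF ends pq(1)] 2(2) by blast
        then show ?thesis
        proof cases
          case 1
          then show ?thesis using pq
            by (intro disjI2 exI[of _ p] exI[of _ q] exI[of _ k] exI[of _ 0]) auto
        next
          case 2
          then show ?thesis using pq reaches_mono[OF pq(3) order_refl, of "Suc n"] by auto
        qed
      next
        case False
        then have "reaches (delete G e) (Suc l) q y" using pq(4) 2(2) reaches_snoc[of "delete G e" l q z f y] by auto
        then show ?thesis using pq
          by (intro disjI2 exI[of _ p] exI[of _ q] exI[of _ k] exI[of _ "Suc l"]) auto
      qed
    qed
  qed auto
qed

text \<open>If deleting \<open>e\<close> destroyed all short walks from \<open>X\<close> to \<open>y\<close> but none from \<open>y\<close> to \<open>X\<close>, one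
  closes up through \<open>y\<close>. Otherwise both kinds of walk are destroyed for the same vertices, and a
  walk avoiding \<open>e\<close> must enter the set of these vertices.\<close>

lemma short_ear:
  assumes ends: "edge_ends_unique G"
    and V: "\<And>a e b. (a, e, b) \<in> G \<Longrightarrow> a \<in> V \<and> b \<in> V"
    and c: "c \<in> X" 
    and from_X: "\<And>v. v \<in> V \<Longrightarrow> \<exists>x\<in>X. reaches G i x v"
    and to_X: "\<And>v. v \<in> V \<Longrightarrow> \<exists>x\<in>X. reaches G i v x"
    and e: "(a, e, b) \<in> G"
    and no_bridge: "\<And>v. (b, e, a) \<in> G \<Longrightarrow> a \<noteq> b \<Longrightarrow> v \<in> V \<Longrightarrow> \<exists>k. reaches (delete G e) k c v"
  shows "\<exists>p q k l. (p, e, q) \<in> G \<and> k + l \<le> 2 * i \<and>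
    (\<exists>x\<in>X. reaches (delete G e) k x p) \<and> (\<exists>x\<in>X. reaches (delete G e) l q x)"
proof -
  define A where "A = {y. \<exists>x\<in>X. reaches (delete G e) i x y}"
  define B where "B = {y. \<exists>x\<in>X. reaches (delete G e) i y x}"
  have A: "\<exists>p q k l. (p, e, q) \<in> G \<and> k + l < i \<and> (\<exists>x\<in>X. reaches (delete G e) k x p) \<and> reaches (delete G e) l q y"
    if "y \<in> V" "y \<notin> A" for y
  proof -
    obtain x where x: "x \<in> X" "reaches G i x y" using from_X \<open>y \<in> V\<close> by blast
    then show ?thesis using reaches_delete_or_split[OF ends x(2), of e] \<open>y \<notin> A\<close> unfolding A_def by blast
  qed
  have B: "\<exists>p q k l. (p, e, q) \<in> G \<and> k + l < i \<and> reaches (delete G e) k y p \<and> (\<exists>x\<in>X. reaches (delete G e) l q x)"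
    if "y \<in> V" "y \<notin> B" for y
  proof -
    obtain x where x: "x \<in> X" "reaches G i y x" using to_X \<open>y \<in> V\<close> by blast
    then show ?thesis using reaches_delete_or_split[OF ends x(2), of e] \<open>y \<notin> B\<close> unfolding B_def by blast
  qed
  have AB: ?thesis if "(p, e, q) \<in> G" "p \<in> A" "q \<in> B" for p q
    using that unfolding A_def B_def
    by (intro exI[of _ p] exI[of _ q] exI[of _ i]) auto
  have loose: "reaches (delete G e) k x p \<Longrightarrow> k \<le> i \<Longrightarrow> reaches (delete G e) i x p" for k x p
    by (rule reaches_mono) auto
  show ?thesis
  proof (rule ccontr)
    assume neg: "\<not> ?thesis"
    have A_sub: "y \<in> B" if y: "y \<in> A" "y \<in> V" for y
    proof (rule ccontr)
      assume "y \<notin> B"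
      then obtain p q k l x where pq: "(p, e, q) \<in> G" "k + l < i" "reaches (delete G e) k y p" "x \<in> X"
        "reaches (delete G e) l q x" using B y by blast
      moreover obtain x' where x': "x' \<in> X" "reaches (delete G e) i x' y" using y by (auto simp: A_def)
      ultimately have "reaches (delete G e) (i + k) x' p" by (blast intro: reaches_trans)
      moreover have "(i + k) + l \<le> 2 * i" using pq by simp
      ultimately show False using neg pq x' by blast
    qed
    have B_sub: "y \<in> A" if y: "y \<in> B" "y \<in> V" for y
    proof (rule ccontr)
      assume "y \<notin> A"
      then obtain p q k l x where pq: "(p, e, q) \<in> G" "k + l < i" "reaches (delete G e) l q y" "x \<in> X"
        "reaches (delete G e) k x p" using A y by blast
      moreover obtain x' where x': "x' \<in> X" "reaches (delete G e) i y x'" using y by (auto simp: B_def)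
      ultimately have "reaches (delete G e) (l + i) q x'" by (blast intro: reaches_trans)
      moreover have "k + (l + i) \<le> 2 * i" using pq by simp
      ultimately show False using neg pq x' by blast
    qed
    \<comment> \<open>\<open>A\<close> and \<open>B\<close> now agree on \<open>V\<close>. With both
      ends of \<open>e\<close> in them there would be an ear, so some vertex misses
      \<open>A\<close>, and a short walk to it from \<open>X\<close> uses \<open>e\<close> from
      \<open>p\<close> in \<open>A\<close> to \<open>q\<close> outside both sets.\<close>
    have "a \<in> A \<longleftrightarrow> a \<in> B" "b \<in> A \<longleftrightarrow> b \<in> B" using A_sub B_sub V[OF e] by blast+
    moreover have "\<not> (a \<in> A \<and> b \<in> B)" using AB[OF e] neg by blast
    ultimately obtain y where "y \<in> V" "y \<notin> A" using V[OF e] by blast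
    then obtain p q k x where pq: "(p, e, q) \<in> G" "k \<le> i" "x \<in> X" "reaches (delete G e) k x p"
      using A[of y] by (meson add_leE less_imp_le_nat)
    then have "p \<in> A" unfolding A_def using loose by blast
    then have "q \<notin> B" using AB neg pq by blast
    then have qA: "q \<notin> A" "q \<in> V" using A_sub V pq by blast+
    \<comment> \<open>The way from \<open>q\<close> to \<open>X\<close> needs \<open>e\<close> too,
      and leaves it in \<open>B\<close>, hence at \<open>p\<close>. So \<open>e\<close> is
      traversable both ways and \<open>no_bridge\<close> applies.\<close>
    obtain p' q' k' l' x' where pq': "(p', e, q') \<in> G" "k' + l' < i" "reaches (delete G e) k' q p'" "x' \<in> X"
        "reaches (delete G e) l' q' x'" using B[OF \<open>q \<in> V\<close> \<open>q \<notin> B\<close>] by blast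
    then have "q' \<in> B" unfolding B_def using loose[of l' q' x'] by auto
    then have "q' = p" "p' = q" using edge_ends_uniqueD[OF ends pq(1) pq'(1)] \<open>q \<notin> B\<close> by auto
    then have "(b, e, a) \<in> G" "a \<noteq> b"
      using pq pq'(1) edge_ends_uniqueD[OF ends e] \<open>p \<in> A\<close> qA by blast+
    then obtain n where "reaches (delete G e) n c q" using no_bridge qA by blast
    moreover have "c \<in> A" using c unfolding A_def by (auto intro: bexI[of _ c])
    \<comment> \<open>The walk to \<open>q\<close> without \<open>e\<close> leaves \<open>A\<close>
      by a dart from \<open>z\<close> to \<open>y\<close>. Since \<open>y\<close> is not in
      \<open>B\<close>, its way to \<open>X\<close> uses \<open>e\<close>. This ear has at most
      \<open>i + 1 + m\<close> steps before \<open>e\<close> and \<open>n'\<close> after it, where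
      \<open>m + n' < i\<close>.\<close>
    ultimately obtain z f y where z: "z \<in> A" "y \<notin> A" "(z, f, y) \<in> delete G e"
      using reaches_first_entry[of "delete G e" n c q "- A"] qA by auto
    obtain x2 where x2: "x2 \<in> X" "reaches (delete G e) i x2 z" using z by (auto simp: A_def)
    have y: "y \<in> V" using V z by auto
    then obtain r s m n' where rs: "(r, e, s) \<in> G" "m + n' < i" "reaches (delete G e) m y r" "\<exists>x\<in>X. reaches (delete G e) n' s x"
      using B[OF y] A_sub B_sub z by blast
    have "s \<in> B" using rs loose[of n' s] unfolding B_def by auto
    then have "(r, e, s) = (q, e, p)" using edge_ends_uniqueD[OF ends pq(1) rs(1)] \<open>q \<notin> B\<close> by auto
    have "reaches (delete G e) (i + Suc m) x2 r"
      using reaches_trans[OF x2(2) reaches_cons[OF z(3) rs(3)]] .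
    moreover have "(i + Suc m) + n' \<le> 2 * i" using rs by simp
    ultimately show False using neg rs x2 by blast
  qed
qed

section \<open>Balanced iteration of the expansion\<close>

lemma expand_core_reversed:
  assumes "edge_ends_unique G"
    and "finite {e. \<exists>a b. (a, e, b) \<in> G}"
    and "core G c X D P Q"
    and "has_ears G X (Suc l)"
  obtains X' D' where "X \<subseteq> X'" "core G c X' D' (P + l + 1) (Q + 2 * l + 1)"
    "\<And>a e b. (a, e, b) \<in> G \<Longrightarrow> a \<in> X \<or> b \<in> X \<Longrightarrow> a \<in> X' \<and> b \<in> X'"
proof -
  have "{e. \<exists>a b. (a, e, b) \<in> reverse G} = {e. \<exists>a b. (a, e, b) \<in> G}" by auto
  then have fin: "finite {e. \<exists>a b. (a, e, b) \<in> reverse G}" using assms(2) by simp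
  obtain X' D' where X': "X \<subseteq> X'" "core (reverse G) c X' D' (Q + 2 * l + 1) (P + l + 1)"
    "\<And>a e b. (a, e, b) \<in> reverse G \<Longrightarrow> a \<in> X \<or> b \<in> X \<Longrightarrow> a \<in> X' \<and> b \<in> X'"
    using expand_core[OF edge_ends_unique_reverse[OF assms(1)] fin core_reverse[OF assms(3)]
      has_ears_reverse[OF assms(4)]] by blast
  show thesis
  proof (rule that[of X' "reverse D'"])
    show "core G c X' (reverse D') (P + l + 1) (Q + 2 * l + 1)"
      using core_reverse[OF X'(2)] by simp
    show "a \<in> X' \<and> b \<in> X'" if "(a, e, b) \<in> G" "a \<in> X \<or> b \<in> X" for a e b
      using X'(3)[of b e a] that by auto
  qed (rule X'(1))
qed

text \<open>After one dart a walk from \<open>X\<close> is in \<open>X'\<close>, since all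
  neighbours have been absorbed; this is why each expansion uses up one unit of the radius.\<close>

lemma reaches_from_neighbourhood:
  assumes "\<exists>x\<in>X. reaches G (Suc i) x v" "X \<subseteq> X'"
    and "\<And>a e b. (a, e, b) \<in> G \<Longrightarrow> a \<in> X \<or> b \<in> X \<Longrightarrow> a \<in> X' \<and> b \<in> X'"
  shows "\<exists>x\<in>X'. reaches G i x v"
  using assms unfolding reaches_Suc_cons by (metis reaches_refl subsetD)

lemma reaches_to_neighbourhood:
  assumes "\<exists>x\<in>X. reaches G (Suc i) v x" "X \<subseteq> X'"
    and "\<And>a e b. (a, e, b) \<in> G \<Longrightarrow> a \<in> X \<or> b \<in> X \<Longrightarrow> a \<in> X' \<and> b \<in> X'"
  shows "\<exists>x\<in>X'. reaches G i v x"
  using assms unfolding reaches_Suc_snoc by (metis reaches_refl subsetD)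

text \<open>Expanding a core costs \<open>2 L - 3\<close> in one direction and \<open>L - 1\<close> in the other, where
  \<open>L = min \<eta> (2 i + 1)\<close>. Always charging the larger cost to the smaller of \<open>P\<close> and \<open>Q\<close> keeps the
  two balanced.\<close>

lemma grow_core:
  assumes ends: "edge_ends_unique G"
    and fin: "finite {e. \<exists>a b. (a, e, b) \<in> G}"
    and V: "\<And>a e b. (a, e, b) \<in> G \<Longrightarrow> a \<in> V \<and> b \<in> V"
    and no_bridge: "\<And>a e b v. (a, e, b) \<in> G \<Longrightarrow> (b, e, a) \<in> G \<Longrightarrow> a \<noteq> b \<Longrightarrow> v \<in> V \<Longrightarrow>
      \<exists>k. reaches (delete G e) k c v"
    and cycles: "\<And>a e b. (a, e, b) \<in> G \<Longrightarrow> \<exists>p q. (p, e, q) \<in> G \<and> reaches (delete G e) (\<eta> - 1) q p"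
    and eta: "\<eta> \<ge> 2"
    and "c \<in> X" "core G c X D P Q"
    and "\<And>v. v \<in> V \<Longrightarrow> \<exists>x\<in>X. reaches G i x v"
    and "\<And>v. v \<in> V \<Longrightarrow> \<exists>x\<in>X. reaches G i v x"
    and "P \<le> Q + (if i = 0 then 2 else min \<eta> (2 * i + 3) - 2)"
    and "Q \<le> P + (if i = 0 then 2 else min \<eta> (2 * i + 3) - 2)"
  shows "\<exists>X D M. V \<subseteq> X \<and> core G c X D M M \<and> 2 * M + 4 * i \<le> P + Q + 3 * (\<Sum>j=1..i. min \<eta> (2 * j + 1)) + 2"
  using assms(7-)
proof (induction i arbitrary: X D P Q)
  case 0
  \<comment> \<open>An imbalance of at most 2 makes the maximum exceed the mean by at most
    1.\<close>
  have "core G c X D (max P Q) (max P Q)"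
    using 0(2) unfolding core_def
    by (meson max.cobounded1 max.cobounded2 order_refl reaches_mono)
  moreover have "V \<subseteq> X" using 0(3) by (auto simp: reaches_0)
  moreover have "2 * max P Q \<le> P + Q + 2" using 0 by (auto simp: max_def)
  ultimately show ?case by (auto intro!: exI[of _ X] exI[of _ D] exI[of _ "max P Q"])
next
  case (Suc i)
  define L where "L = min \<eta> (2 * Suc i + 1)"
  have "L \<ge> 2" using eta unfolding L_def by simp
  then obtain l where l: "L = l + 2" using le_Suc_ex by (metis add.commute)
  have ears: "has_ears G X (Suc l)"
    unfolding has_ears_def
  proof (intro allI impI)
    fix a e b assume e: "(a, e, b) \<in> G" "(a \<in> X) \<noteq> (b \<in> X)"
    have crossing: "(p \<in> X) \<noteq> (q \<in> X)" if "(p, e, q) \<in> G" for p q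
      using that e edge_ends_uniqueD[OF ends] by metis
    \<comment> \<open>The two alternatives of the minimum \<open>L\<close>: a cycle of length at
      most \<open>\<eta>\<close> through \<open>e\<close> serves as an ear, or
      \<open>short_ear\<close> supplies one.\<close>
    consider "Suc l = \<eta> - 1" | "Suc l = 2 * Suc i" using l unfolding L_def by linarith
    then obtain p q where pq: "(p, e, q) \<in> G"
       "p \<in> X \<longrightarrow> (\<exists>x\<in>X. reaches (delete G e) (Suc l) q x)"
       "q \<in> X \<longrightarrow> (\<exists>x\<in>X. reaches (delete G e) (Suc l) x p)"
    proof cases
      case 1
      then show ?thesis using cycles[OF e(1)] that by metis
    next
      case 2
      have "\<exists>p q k l. (p, e, q) \<in> G \<and> k + l \<le> 2 * Suc i \<and>
          (\<exists>x\<in>X. reaches (delete G e) k x p) \<and> (\<exists>x\<in>X. reaches (delete G e) l q x)"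
        by (rule short_ear[where V = V and c = c, OF ends])
          (use V Suc.prems(1,3,4) e(1) no_bridge in blast)+
      then obtain p q k m x y where pq: "(p, e, q) \<in> G" "k + m \<le> Suc l" "x \<in> X"
        "reaches (delete G e) k x p" "y \<in> X" "reaches (delete G e) m q y"
        using 2 by auto
      moreover have "reaches (delete G e) (Suc l) x p" "reaches (delete G e) (Suc l) q y"
        using pq reaches_mono[OF _ order_refl] by (meson add_leD1 add_leD2)+
      ultimately show ?thesis using that by blast
    qed
    then show "\<exists>p q. (p, e, q) \<in> G \<and>
       (p \<in> X \<and> q \<notin> X \<and> (\<exists>x\<in>X. reaches (delete G e) (Suc l) q x) \<or>
        p \<notin> X \<and> q \<in> X \<and> (\<exists>x\<in>X. reaches (delete G e) (Suc l) x p))"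
      using crossing by blast
  qed
  \<comment> \<open>The new imbalance is at most \<open>l\<close> on the side charged more, which is
    \<open>H\<close> unless \<open>i = 0\<close>. On the other side it is at most the growth of the
    minimum from one index to the next, hence at most 2; only for \<open>i = 0\<close> can this
    exceed \<open>l\<close>.\<close>
  define H where "H = (if i = 0 then 2 else min \<eta> (2 * i + 3) - 2)"
  have step: "\<exists>P' Q' X' D'. P' + Q' = P + Q + 3 * l + 2 \<and> P' \<le> Q' + H \<and> Q' \<le> P' + H \<and>
    X \<subseteq> X' \<and> core G c X' D' P' Q' \<and>
    (\<forall>a e b. (a, e, b) \<in> G \<longrightarrow> a \<in> X \<or> b \<in> X \<longrightarrow> a \<in> X' \<and> b \<in> X')"
  proof (cases "P \<le> Q")
    case True
    obtain X' D' where X': "X \<subseteq> X'" "core G c X' D' (P + 2 * l + 1) (Q + l + 1)"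
      "\<And>a e b. (a, e, b) \<in> G \<Longrightarrow> a \<in> X \<or> b \<in> X \<Longrightarrow> a \<in> X' \<and> b \<in> X'"
      using expand_core[OF ends fin Suc.prems(2) ears] by blast
    have "P + 2 * l + 1 \<le> (Q + l + 1) + H" "Q + l + 1 \<le> (P + 2 * l + 1) + H"
      using True Suc.prems(5,6) l eta unfolding H_def L_def by (auto simp: min_def split: if_splits)
    then show ?thesis using X'
      by (intro exI[of _ "P + 2 * l + 1"] exI[of _ "Q + l + 1"] exI[of _ X'] exI[of _ D']) auto
  next
    case False
    obtain X' D' where X': "X \<subseteq> X'" "core G c X' D' (P + l + 1) (Q + 2 * l + 1)"
      "\<And>a e b. (a, e, b) \<in> G \<Longrightarrow> a \<in> X \<or> b \<in> X \<Longrightarrow> a \<in> X' \<and> b \<in> X'"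
      using expand_core_reversed[OF ends fin Suc.prems(2) ears] by blast
    have "P + l + 1 \<le> (Q + 2 * l + 1) + H" "Q + 2 * l + 1 \<le> (P + l + 1) + H"
      using False Suc.prems(5,6) l eta unfolding H_def L_def by (auto simp: min_def split: if_splits)
    then show ?thesis using X'
      by (intro exI[of _ "P + l + 1"] exI[of _ "Q + 2 * l + 1"] exI[of _ X'] exI[of _ D']) auto
  qed
  then obtain P' Q' X' D' where X': "P' + Q' = P + Q + 3 * l + 2" "P' \<le> Q' + H" "Q' \<le> P' + H"
    "X \<subseteq> X'" "core G c X' D' P' Q'" "\<And>a e b. (a, e, b) \<in> G \<Longrightarrow> a \<in> X \<or> b \<in> X \<Longrightarrow> a \<in> X' \<and> b \<in> X'"
    by blast
  have "c \<in> X'" using Suc.prems(1) X'(4) by blast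
  have from_X: "\<exists>x\<in>X'. reaches G i x v" if "v \<in> V" for v
    using reaches_from_neighbourhood[OF Suc.prems(3)[OF that] X'(4,6)] .
  have to_X: "\<exists>x\<in>X'. reaches G i v x" if "v \<in> V" for v
    using reaches_to_neighbourhood[OF Suc.prems(4)[OF that] X'(4,6)] .
  obtain X2 D2 M where M: "V \<subseteq> X2" "core G c X2 D2 M M"
      "2 * M + 4 * i \<le> P' + Q' + 3 * (\<Sum>j=1..i. min \<eta> (2 * j + 1)) + 2"
    using Suc.IH[OF \<open>c \<in> X'\<close> X'(5) from_X to_X] X'(2,3) unfolding H_def by blast
  have "2 * M + 4 * Suc i \<le> P + Q + 3 * (\<Sum>j=1..Suc i. min \<eta> (2 * j + 1)) + 2"
    using M(3) X'(1) l unfolding L_def by simp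
  then show ?case using M by blast
qed

section \<open>Mixed multigraphs\<close>

lemma edge_ends_unique_darts: "edge_ends_unique (darts G)"
  unfolding edge_ends_unique_def darts_def traversable_def by auto

lemma darts_verts:
  assumes "finite_mixed_multigraph G" "(a, e, b) \<in> darts G"
  shows "a \<in> verts G \<and> b \<in> verts G"
  using assms unfolding finite_mixed_multigraph_def darts_def traversable_def by fastforce

lemma dart_exists:
  assumes "e \<in> edges G"
  shows "\<exists>a b. (a, e, b) \<in> darts G"
proof (cases "ends G e")
  case (Undirected p)
  then show ?thesis using assms by (cases p) (auto simp: darts_def traversable_def)
next
  case (Directed a b)
  then show ?thesis using assms by (auto simp: darts_def traversable_def)
qed

lemma darts_remove_edge: "darts (remove_edge G e) = delete (darts G) e"
  by (auto simp: darts_def remove_edge_def traversable_def delete_def)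

lemma finite_remove_edge: "finite_mixed_multigraph G \<Longrightarrow> finite_mixed_multigraph (remove_edge G e)"
  by (auto simp: finite_mixed_multigraph_def remove_edge_def)

lemma verts_remove_edge [simp]: "verts (remove_edge G e) = verts G"
  by (simp add: remove_edge_def)

section \<open>Paths, cycles and distances in terms of dart walks\<close>

lemma reaches_nth:
  assumes "i \<le> j" "\<And>k. i \<le> k \<Longrightarrow> k < j \<Longrightarrow> (vs ! k, es ! k, vs ! Suc k) \<in> D"
  shows "reaches D (j - i) (vs ! i) (vs ! j)"
  using assms
proof (induction j rule: dec_induct)
  case (step j)
  then have "reaches D (Suc (j - i)) (vs ! i) (vs ! Suc j)"
    by (intro reaches_snoc) auto
  then show ?case using step by (simp add: Suc_diff_le)
qed simp

lemma reaches_of_walk: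
  assumes "is_walk G vs es"
  shows "reaches (darts G) (length es) (hd vs) (last vs)"
proof -
  have len: "length vs = Suc (length es)" using assms by (simp add: is_walk_def)
  then have "hd vs = vs ! 0" "last vs = vs ! length es"
    by (metis hd_conv_nth list.size(3) nat.distinct(1), metis diff_Suc_1 last_conv_nth list.size(3) nat.distinct(1))
  then show ?thesis
    using reaches_nth[of 0 "length es" vs es "darts G"] assms by (auto simp: is_walk_def darts_def)
qed

text \<open>A walk of least length repeats no vertex. It repeats no edge either, because the ends of
  an edge are determined by the edge, so a repetition would bring back an earlier vertex.\<close>

lemma path_of_reaches:
  assumes G: "finite_mixed_multigraph G" and u: "u \<in> verts G" and "reaches (darts G) n u v"
  obtains vs es where "is_path_from_to G u vs es v" "distinct vs" "length es \<le> n"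
proof -
  let ?R = "arcs (darts G)"
  obtain k0 where k0: "k0 \<le> n" "(u, v) \<in> ?R ^^ k0" using assms by (auto simp: reaches_def)
  define k where "k = (LEAST k. (u, v) \<in> ?R ^^ k)"
  have k: "(u, v) \<in> ?R ^^ k" and k_min: "\<And>j. (u, v) \<in> ?R ^^ j \<Longrightarrow> k \<le> j"
    unfolding k_def using k0(2) by (auto intro: LeastI Least_le)
  obtain f where f: "f 0 = u" "f k = v" "\<And>i. i < k \<Longrightarrow> (f i, f (Suc i)) \<in> ?R"
    using k unfolding relpow_fun_conv by blast
  obtain g where g: "\<And>i. i < k \<Longrightarrow> (f i, g i, f (Suc i)) \<in> darts G"
    using f(3) unfolding in_arcs by metis
  have seg: "(f i, f j) \<in> ?R ^^ (j - i)" if "i \<le> j" "j \<le> k" for i j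
    unfolding relpow_fun_conv using that f(3) by (intro exI[of _ "\<lambda>m. f (i + m)"]) auto
  have f_inj: "f i \<noteq> f j" if "i < j" "j \<le> k" for i j
  proof
    assume "f i = f j"
    then have "(u, v) \<in> ?R ^^ (i + (k - j))"
      using relpow_trans[of u "f i" i ?R v "k - j"] seg[of 0 i] seg[of j k] that f by auto
    then show False using k_min[of "i + (k - j)"] that by simp
  qed
  have inj: "inj_on f {0..<Suc k}"
    by (rule linorder_inj_onI) (use f_inj in auto)
  have g_inj: "inj_on g {0..<k}"
  proof (rule linorder_inj_onI)
    fix i j assume ij: "i < j" "i \<in> {0..<k}" "j \<in> {0..<k}"
    show "g i \<noteq> g j"
    proof
      assume "g i = g j"
      then have "f j = f i \<or> f (Suc j) = f i"
        using edge_ends_uniqueD[OF edge_ends_unique_darts, of "f i" "g i" "f (Suc i)" G "f j" "f (Suc j)"]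
          g[of i] g[of j] ij by auto
      then show False using f_inj[of i j] f_inj[of i "Suc j"] ij by auto
    qed
  qed auto
  define vs es where "vs = map f [0..<Suc k]" and "es = map g [0..<k]"
  have nth: "i \<le> k \<Longrightarrow> vs ! i = f i" "i < k \<Longrightarrow> es ! i = g i" for i
    unfolding vs_def es_def by (simp_all del: upt_Suc)
  have len: "length vs = Suc k" "length es = k" by (simp_all add: vs_def es_def)
  have "f i \<in> verts G" if "i \<le> k" for i
    using that darts_verts[OF G g, of "i - 1"] f(1) u by (cases i) auto
  then have "set vs \<subseteq> verts G" unfolding vs_def by auto
  moreover have "distinct vs" "distinct es"
    unfolding vs_def es_def using inj g_inj by (simp_all add: distinct_map del: upt_Suc)
  moreover have "traversable G (vs ! i) (es ! i) (vs ! Suc i)" if "i < k" for i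
    using g[OF that] nth that by (simp add: darts_def)
  ultimately have "is_path G vs es"
    unfolding is_path_def is_trail_def is_walk_def using len by (auto simp: nth_eq_iff_index_eq)
  moreover have "hd vs = u" "last vs = v"
    unfolding vs_def using f(1,2) by (simp_all add: hd_map del: upt_Suc) (simp add: last_map)
  ultimately have "is_path_from_to G u vs es v" by (simp add: is_path_from_to_def)
  then show thesis using that \<open>distinct vs\<close> len k_min[OF k0(2)] k0(1) by auto
qed

lemma reaches_of_path: "is_path_from_to G u vs es v \<Longrightarrow> reaches (darts G) (length es) u v"
  using reaches_of_walk[of G vs es] by (auto simp: is_path_from_to_def is_path_def is_trail_def)

lemma distance_le_iff:
  assumes "finite_mixed_multigraph G" "u \<in> verts G"
  shows "distance G u v \<le> enat n \<longleftrightarrow> reaches (darts G) n u v"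
proof
  assume "distance G u v \<le> enat n"
  then have "distance G u v < enat (Suc n)" by (simp add: order_le_less_trans)
  then obtain vs es where "is_path_from_to G u vs es v" "length es < Suc n"
    unfolding distance_def Inf_less_iff by auto
  then show "reaches (darts G) n u v"
    using reaches_mono[OF reaches_of_path order_refl] by fastforce
next
  assume "reaches (darts G) n u v"
  then obtain vs es where "is_path_from_to G u vs es v" "length es \<le> n"
    using path_of_reaches[OF assms] by blast
  then show "distance G u v \<le> enat n"
    unfolding distance_def by (intro Inf_lower2[of "enat (length es)"]) auto
qed

lemma eccentricity_le_iff:
  assumes "finite_mixed_multigraph G" "c \<in> verts G"
  shows "eccentricity G c \<le> enat n \<longleftrightarrow>
    (\<forall>v\<in>verts G. reaches (darts G) n c v \<and> reaches (darts G) n v c)"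
  using assms by (auto simp: eccentricity_def SUP_le_iff distance_le_iff)

text \<open>The cycle is cut at \<open>e\<close> and its two remaining pieces are joined at the base
  point; they avoid \<open>e\<close> because no edge is repeated.\<close>

lemma reaches_of_cycle:
  assumes "is_cycle G vs es" "e \<in> set es"
  shows "\<exists>p q. (p, e, q) \<in> darts G \<and> reaches (delete (darts G) e) (length es - 1) q p"
proof -
  obtain i where i: "i < length es" "es ! i = e" using assms(2) by (auto simp: in_set_conv_nth)
  have len: "length vs = Suc (length es)" and d: "distinct es" "vs \<noteq> []"
    and tr: "\<And>k. k < length es \<Longrightarrow> (vs ! k, es ! k, vs ! Suc k) \<in> darts G"
    using assms by (auto simp: is_cycle_def is_path_def is_trail_def is_walk_def darts_def)
  have closed: "vs ! 0 = vs ! length es"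
    using assms(1) len d by (simp add: is_cycle_def hd_conv_nth last_conv_nth)
  have avoid: "(vs ! k, es ! k, vs ! Suc k) \<in> delete (darts G) e" if "k < length es" "k \<noteq> i" for k
    using tr[OF that(1)] that i d by (auto simp: nth_eq_iff_index_eq)
  have "reaches (delete (darts G) e) (length es - Suc i) (vs ! Suc i) (vs ! length es)"
    by (rule reaches_nth[where es = es]) (use i avoid in auto)
  moreover have "reaches (delete (darts G) e) (i - 0) (vs ! 0) (vs ! i)"
    by (rule reaches_nth[where es = es]) (use i avoid in auto)
  ultimately have "reaches (delete (darts G) e) ((length es - Suc i) + (i - 0)) (vs ! Suc i) (vs ! i)"
    using closed by (auto intro: reaches_trans)
  moreover have "(length es - Suc i) + (i - 0) = length es - 1" using i by auto
  moreover have "(vs ! i, e, vs ! Suc i) \<in> darts G" using tr i by auto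
  ultimately show ?thesis by metis
qed

lemma cycle_of_reaches:
  assumes G: "finite_mixed_multigraph G" and e: "(p, e, q) \<in> darts G"
    and "reaches (delete (darts G) e) n q p"
  shows "\<exists>vs es. is_cycle G vs es \<and> e \<in> set es \<and> length es \<le> Suc n"
proof -
  have "q \<in> verts (remove_edge G e)" "p \<in> verts G" using darts_verts[OF G e] by simp_all
  then obtain vs es where P: "is_path_from_to (remove_edge G e) q vs es p" "distinct vs" "length es \<le> n"
    using path_of_reaches[OF finite_remove_edge[OF G]] assms(3) unfolding darts_remove_edge by blast
  have len: "length vs = Suc (length es)" and "hd vs = q" "last vs = p" and "set vs \<subseteq> verts G" "distinct es"
    and tr: "\<And>k. k < length es \<Longrightarrow> (vs ! k, es ! k, vs ! Suc k) \<in> delete (darts G) e"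
    using P(1) unfolding is_path_from_to_def is_path_def is_trail_def is_walk_def
    by (simp_all flip: darts_remove_edge) (simp add: darts_def)
  then have ends: "vs ! 0 = q" "vs ! length es = p"
    by (metis hd_conv_nth list.size(3) nat.distinct(1), metis diff_Suc_1 last_conv_nth list.size(3) nat.distinct(1))
  have "e \<notin> set es" using tr by (auto simp: in_set_conv_nth)
  moreover have "traversable G ((p # vs) ! i) ((e # es) ! i) ((p # vs) ! Suc i)" if "i < Suc (length es)" for i
    using that e ends tr[of "i - 1"] by (cases i) (auto simp: darts_def)
  ultimately have "is_trail G (p # vs) (e # es)"
    using len \<open>p \<in> verts G\<close> \<open>set vs \<subseteq> verts G\<close> \<open>distinct es\<close> unfolding is_trail_def is_walk_def by simp
  moreover have "i = 0 \<and> Suc j = length (p # vs)"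
    if "i < j" "j < length (p # vs)" "(p # vs) ! i = (p # vs) ! j" for i j
  proof -
    obtain j' where j': "j = Suc j'" using \<open>i < j\<close> by (cases j) auto
    show ?thesis
    proof (cases i)
      case 0
      then have "vs ! j' = vs ! length es" using that ends j' by simp
      then show ?thesis using 0 that P(2) len j' by (simp add: nth_eq_iff_index_eq)
    next
      case (Suc i')
      then show ?thesis using that P(2) j' by (simp add: nth_eq_iff_index_eq)
    qed
  qed
  ultimately have "is_cycle G (p # vs) (e # es)"
    using \<open>last vs = p\<close> len unfolding is_cycle_def is_path_def by auto
  then show ?thesis using P(3) by (intro exI[of _ "p # vs"] exI[of _ "e # es"]) auto
qed

section \<open>From a core to the oriented radius\<close>

lemma orientation_extending:
  assumes "D \<subseteq> darts G" "oriented D"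
  obtains H where "is_orientation G H" "D \<subseteq> darts H"
proof -
  have "\<exists>w. e \<in> edges G \<longrightarrow> (ends G e = Directed (fst w) (snd w) \<or> ends G e = Undirected (Upair (fst w) (snd w))) \<and>
     (\<forall>a b. (a, e, b) \<in> D \<longrightarrow> w = (a, b))" for e
  proof (cases "\<exists>a b. (a, e, b) \<in> D")
    case True
    then obtain a b where ab: "(a, e, b) \<in> D" by blast
    then show ?thesis using assms unfolding oriented_def darts_def traversable_def
      by (intro exI[of _ "(a, b)"]) auto
  next
    case False
    then show ?thesis using dart_exists[of e G] unfolding darts_def traversable_def by fastforce
  qed
  then obtain w where w: "\<And>e. e \<in> edges G \<Longrightarrow>
      ends G e = Directed (fst (w e)) (snd (w e)) \<or> ends G e = Undirected (Upair (fst (w e)) (snd (w e)))"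
    "\<And>e a b. e \<in> edges G \<Longrightarrow> (a, e, b) \<in> D \<Longrightarrow> w e = (a, b)"
    by metis
  show thesis
  proof (rule that[of "G\<lparr>ends := \<lambda>e. Directed (fst (w e)) (snd (w e))\<rparr>"])
    show "is_orientation G (G\<lparr>ends := \<lambda>e. Directed (fst (w e)) (snd (w e))\<rparr>)"
      using w(1) by (auto simp: is_orientation_def)
    show "D \<subseteq> darts (G\<lparr>ends := \<lambda>e. Directed (fst (w e)) (snd (w e))\<rparr>)"
      using w(2) assms(1) by (fastforce simp: darts_def traversable_def)
  qed
qed

lemma finite_orientation:
  assumes "finite_mixed_multigraph G" "is_orientation G H"
  shows "finite_mixed_multigraph H"
  using assms unfolding finite_mixed_multigraph_def is_orientation_def by fastforce

text \<open>Orienting the edges without a dart in \<open>D\<close> arbitrarily only adds darts, so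
  the distances guaranteed by the core survive.\<close>

lemma oriented_radius_le:
  assumes G: "finite_mixed_multigraph G" and c: "c \<in> verts G" and "verts G \<subseteq> X"
    and core: "core (darts G) c X D M M"
  shows "oriented_radius G \<le> enat M"
proof -
  obtain H where H: "is_orientation G H" "D \<subseteq> darts H"
    using orientation_extending core unfolding core_def by metis
  have "eccentricity H c \<le> enat M"
    using core c assms(3) H reaches_mono[OF _ H(2) order_refl]
    unfolding eccentricity_le_iff[OF finite_orientation[OF G H(1)]] core_def is_orientation_def
    by (subst eccentricity_le_iff[OF finite_orientation[OF G H(1)]]) blast+
  then have "radius H \<le> enat M"
    using H(1) c unfolding radius_def is_orientation_def by (metis INF_lower2)
  then show ?thesis unfolding oriented_radius_def using H(1) by (intro Inf_lower2) auto
qed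

text \<open>The deficits \<open>\<eta> - min \<eta> (2 * j + 1)\<close> are \<eta> - 3, \<eta> - 5,
  ... as long as they are positive, with sum (\<eta> - 1)(\<eta> - 3)/4 for odd \<eta> and 1/4 more
  for even \<eta>. So odd \<eta> gives equality. Once \<open>\<eta> \<le> 2 * r + 1\<close>,
  increasing \<open>r\<close> adds the same amount to both sides; the computation takes place at the
  least such \<open>r\<close>.\<close>

lemma ear_sum_bound:
  assumes "2 \<le> \<eta>" "\<eta> \<le> 2 * r + 1"
  shows "3 * real (\<Sum>j=1..r. min \<eta> (2 * j + 1)) + 2 - 4 * real r
     \<le> 2 * (1.5 * real r * real \<eta> - 0.375 * (real \<eta> - 1) * (real \<eta> - 3) - 2 * real r + 1)"
  using assms
proof (induction r)
  case (Suc r)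
  show ?case
  proof (cases "\<eta> \<le> 2 * r + 1")
    case True
    define S where "S = real (\<Sum>j=1..r. min \<eta> (2 * j + 1))"
    have "real (\<Sum>j=1..Suc r. min \<eta> (2 * j + 1)) = S + real \<eta>"
      unfolding S_def using True by (simp add: min_def)
    then show ?thesis using Suc.IH[OF Suc.prems(1) True]
      unfolding S_def[symmetric] by (simp add: field_simps)
  next
    case False
    have sum: "(\<Sum>j=1..m. min \<eta> (2 * j + 1)) = m * m + 2 * m" if "m \<le> r" for m
      using that False by (induction m) auto
    have "\<eta> = 2 * r + 2 \<or> \<eta> = 2 * r + 3" using False Suc.prems(2) by arith
    moreover have "min \<eta> (2 * Suc r + 1) = \<eta>" using Suc.prems(2) by simp
    then have "real (\<Sum>j=1..Suc r. min \<eta> (2 * j + 1)) = real r * real r + 2 * real r + real \<eta>"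
      using sum[of r] by (simp flip: of_nat_sum)
    ultimately show ?thesis
      by (elim disjE) (simp_all add: field_simps)
  qed
qed simp

lemma reaches_without_edge:
  assumes G: "finite_mixed_multigraph G" "bridgeless G" and c: "c \<in> verts G" "v \<in> verts G"
    and "(a, e, b) \<in> darts G" "(b, e, a) \<in> darts G" "a \<noteq> b"
  shows "\<exists>k. reaches (delete (darts G) e) k c v"
proof (cases "c = v")
  case False
  have "e \<in> edges G" "\<exists>p. ends G e = Undirected p"
    using assms(5-) by (auto simp: darts_def traversable_def)
  then have "strongly_connected (remove_edge G e)"
    using G(2) unfolding bridgeless_def is_bridge_def by blast
  then obtain vs es where "is_path_from_to (remove_edge G e) c vs es v"
    using False c unfolding strongly_connected_def by (metis verts_remove_edge)
  then show ?thesis using reaches_of_path darts_remove_edge by metis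
qed (auto intro: reaches_refl)

theorem theorem5:
  fixes G :: "('v, 'e) mixed_multigraph" and r \<eta> :: nat
  assumes "finite_mixed_multigraph G"
    and "strongly_connected G"
    and "bridgeless G"
    and "radius G = enat r"
    and "r \<ge> 1"
    and "\<eta> = eta G"
  shows "ereal_of_enat (oriented_radius G)
           \<le> ereal (1.5 * real r * real \<eta> - 0.375 * (real \<eta> - 1) * (real \<eta> - 3) - 2 * real r + 1)
       \<and> 1.5 * real r * real \<eta> - 0.375 * (real \<eta> - 1) * (real \<eta> - 3) - 2 * real r + 1
           \<le> 1.5 * real r * real \<eta>"
proof -
  note fin = assms(1)
  \<comment> \<open>The strict bound makes the infimum yield an actual centre.\<close>
  have "radius G < enat (Suc r)" using assms(4) by simp
  then obtain c where c: "c \<in> verts G" "eccentricity G c < enat (Suc r)"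
    unfolding radius_def INF_less_iff by blast
  then have "eccentricity G c \<le> enat r"
    by (cases "eccentricity G c") auto
  then have dist: "reaches (darts G) r c v" "reaches (darts G) r v c" if "v \<in> verts G" for v
    using that eccentricity_le_iff[OF fin c(1)] by blast+
  have no_bridge: "\<exists>k. reaches (delete (darts G) e) k c v"
    if "(a, e, b) \<in> darts G" "(b, e, a) \<in> darts G" "a \<noteq> b" "v \<in> verts G" for a e b v
    using reaches_without_edge[OF fin assms(3) c(1)] that by blast
  \<comment> \<open>An ear at the one-vertex core \<open>{c}\<close> closes to a cycle. This makes
    the set behind the \<open>LEAST\<close> in \<open>eta\<close> nonempty and bounds its minimum by
    \<open>2 * r + 1\<close>.\<close>
  have "\<exists>vs es. is_cycle G vs es \<and> e \<in> set es \<and> length es \<le> 2 * r + 1" if e: "e \<in> edges G" for e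
  proof -
    obtain a b where ab: "(a, e, b) \<in> darts G" using dart_exists[OF e] by blast
    have "\<exists>p q k l. (p, e, q) \<in> darts G \<and> k + l \<le> 2 * r \<and>
      (\<exists>x\<in>{c}. reaches (delete (darts G) e) k x p) \<and> (\<exists>x\<in>{c}. reaches (delete (darts G) e) l q x)"
      by (rule short_ear[where V = "verts G" and c = c, OF edge_ends_unique_darts])
        (use darts_verts[OF fin] dist ab no_bridge[OF ab] in auto)
    then obtain p q k l where pq: "(p, e, q) \<in> darts G" "k + l \<le> 2 * r"
      "reaches (delete (darts G) e) k c p" "reaches (delete (darts G) e) l q c" by blast
    have "reaches (delete (darts G) e) (2 * r) q p"
      by (rule reaches_mono[OF reaches_trans[OF pq(4,3)]]) (use pq(2) in auto)
    then show ?thesis using cycle_of_reaches[OF fin pq(1)] by simp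
  qed
  then have all: "\<forall>e\<in>edges G. \<exists>vs es. is_cycle G vs es \<and> e \<in> set es \<and> length es \<le> 2 * r + 1"
    by blast
  then have eta_le: "\<eta> \<le> 2 * r + 1"
    unfolding assms(6) eta_def by (rule Least_le)
  have eta: "\<forall>e\<in>edges G. \<exists>vs es. is_cycle G vs es \<and> e \<in> set es \<and> length es \<le> \<eta>"
    unfolding assms(6) eta_def using all by (rule LeastI)
  have cycles: "\<exists>p q. (p, e, q) \<in> darts G \<and> reaches (delete (darts G) e) (\<eta> - 1) q p"
    if "(a, e, b) \<in> darts G" for a e b
  proof -
    have "e \<in> edges G" using that by (simp add: darts_def traversable_def)
    then obtain vs es where C: "is_cycle G vs es" "e \<in> set es" "length es \<le> \<eta>" using eta by blast
    obtain p q where "(p, e, q) \<in> darts G" "reaches (delete (darts G) e) (length es - 1) q p"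
      using reaches_of_cycle[OF C(1,2)] by blast
    then show ?thesis using reaches_mono[OF _ order_refl] C(3) by (meson diff_le_mono)
  qed
  \<comment> \<open>Positive radius forces a second vertex, hence an edge that is not a loop, whose
    cycles have at least two edges.\<close>
  have "\<exists>v\<in>verts G. v \<noteq> c"
  proof (rule ccontr)
    assume "\<not> ?thesis"
    then have "eccentricity G c \<le> enat 0"
      unfolding eccentricity_le_iff[OF fin c(1)] by auto
    then have "radius G \<le> enat 0" using c(1) unfolding radius_def by (metis INF_lower2)
    then show False using assms(4,5) by simp
  qed
  then obtain v where v: "v \<in> verts G" "v \<noteq> c" by blast
  obtain w f where wf: "(w, f, v) \<in> darts G" "w \<noteq> v"
    using reaches_first_entry[OF dist(1)[OF v(1)], of "{v}"] v(2) by auto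
  have "\<eta> \<ge> 2"
  proof (rule ccontr)
    assume "\<not> ?thesis"
    then have "\<eta> - 1 = 0" by simp
    then obtain p where "(p, f, p) \<in> darts G" using cycles[OF wf(1)] by (auto simp: reaches_0)
    then show False using edge_ends_uniqueD[OF edge_ends_unique_darts wf(1)] wf(2) by blast
  qed
  have "finite {e. \<exists>a b. (a, e, b) \<in> darts G}"
    by (rule finite_subset[of _ "edges G"])
      (use fin in \<open>auto simp: darts_def traversable_def finite_mixed_multigraph_def\<close>)
  moreover have "core (darts G) c {c} {} 0 0" by (simp add: core_def oriented_def)
  ultimately have "\<exists>X D M. verts G \<subseteq> X \<and> core (darts G) c X D M M \<and>
      2 * M + 4 * r \<le> 0 + 0 + 3 * (\<Sum>j=1..r. min \<eta> (2 * j + 1)) + 2"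
    by (intro grow_core[OF edge_ends_unique_darts, where V = "verts G"])
      (use darts_verts[OF fin] no_bridge cycles \<open>\<eta> \<ge> 2\<close> dist in auto)
  then obtain X D M where M: "verts G \<subseteq> X" "core (darts G) c X D M M"
    "2 * M + 4 * r \<le> 3 * (\<Sum>j=1..r. min \<eta> (2 * j + 1)) + 2" by auto
  define B where "B = 1.5 * real r * real \<eta> - 0.375 * (real \<eta> - 1) * (real \<eta> - 3) - 2 * real r + 1"
  have "2 * real M + 4 * real r \<le> 3 * real (\<Sum>j=1..r. min \<eta> (2 * j + 1)) + 2"
    using M(3) by (metis (mono_tags, lifting) of_nat_add of_nat_le_iff of_nat_mult of_nat_numeral)
  then have "real M \<le> B"
    using ear_sum_bound[OF \<open>\<eta> \<ge> 2\<close> eta_le] unfolding B_def[symmetric] by linarith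
  then have "ereal (real M) \<le> ereal B" by simp
  moreover have "ereal_of_enat (oriented_radius G) \<le> ereal (real M)"
    using oriented_radius_le[OF fin c(1) M(1,2)]
    by (metis ereal_of_enat_le_iff ereal_of_enat_simps(1))
  ultimately have "ereal_of_enat (oriented_radius G) \<le> ereal B" by (rule order_trans[rotated])
  \<comment> \<open>The product is negative only for \<open>\<eta> = 2\<close>, where it contributes
    -0.375, and \<open>2 * r \<ge> 2\<close> compensates.\<close>
  moreover have "0.375 * (real \<eta> - 1) * (real \<eta> - 3) + 2 * real r \<ge> 1"
  proof (cases "\<eta> = 2")
    case False
    then have "0 \<le> 0.375 * (real \<eta> - 1) * (real \<eta> - 3)"
      using \<open>\<eta> \<ge> 2\<close> by (intro mult_nonneg_nonneg) auto
    moreover have "real r \<ge> 1" using assms(5) by simp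
    ultimately show ?thesis by linarith
  qed (use assms(5) in auto)
  then have "B \<le> 1.5 * real r * real \<eta>" unfolding B_def by linarith
  ultimately show ?thesis unfolding B_def by blast
qed

end
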